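(* Let $f(x) \in \mathbb{Z}[x]$ be a monic polynomial. There is a positive integer $N = N(f)$ such that \[ f(p) \mid f(p^{p}) \quad \text{for all primes } p \geq N \] if and only if there are positive integers $d_{1},\dots,d_{m}$ and nonnegative integers $e_{0},e_{1},\dots,e_{m}$ such that \[ f(x)=x^{e_{0}}\Phi_{d_{1}}(x)^{e_{1}}\Phi_{d_{2}}(x)^{e_{2}}\cdots \Phi_{d_{m}}(x)^{e_{m}}, \] where $\Phi_{d}(x)$ denotes the $d$-th cyclotomic polynomial. *)

theory Defs
  imports
    Complex_Main
    "HOL-Computational_Algebra.Computational_Algebra"
    "HOL-Number_Theory.Totient"
begin

(* The product of X - \<zeta> over the primitive n-th roots of unity \<zeta> = exp (2 pi i k / n),
   1 \<le> k \<le> n, gcd k n = 1.  It is taken over the complex numbers, so an integer polynomial has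
   to be mapped by of_int (an injective ring homomorphism) before it is compared with it.
   The value at n = 0 (the empty product 1) has no meaning. *)
definition cyclotomic_poly :: "nat \<Rightarrow> complex poly" where
  "cyclotomic_poly n = (\<Prod>k\<in>totatives n. [:- cis (2 * pi * real k / real n), 1:])"

end

theory Submission
  imports Defs
    "HOL-Number_Theory.Pocklington"
    "HOL-Number_Theory.Prime_Powers"
    "HOL-Analysis.Summation_Tests"
begin

text \<open>
  Suppose the divisibility holds for all large primes, let \<open>q\<close> be a prime and \<open>n\<close> a root of \<open>f\<close> modulo
  \<open>q\<close>, of multiplicative order \<open>k\<close>. By Dirichlet's theorem there are large primes \<open>p\<close> with \<open>p = n\<close>
  modulo \<open>q\<close> and \<open>p = b\<close> modulo \<open>k\<close> for any \<open>b\<close> coprime to \<open>k\<close>; hence every \<open>n ^ b\<close> is again a root of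
  \<open>f\<close> modulo \<open>q\<close>. So \<open>totient k \<le> degree f\<close>, and \<open>k\<close> divides a number \<open>L\<close> that depends only on the
  degree. A nonzero root of \<open>f\<close> that is not an \<open>L\<close>-th root of unity would have a minimal polynomial
  coprime to \<open>X (X ^ L - 1)\<close>, contradicting Schur's theorem that its values have infinitely many
  prime divisors. Hence all nonzero roots are roots of unity, and conjugate ones have equal multiplicity.
  Conversely, \<open>\<Phi>\<^sub>d(X)\<close> divides \<open>\<Phi>\<^sub>d(X ^ p)\<close> whenever \<open>p\<close> does not divide \<open>d\<close>.

  Dirichlet's theorem is proved by Shapiro's elementary method, from Mertens-type estimates for
  \<open>\<Sum> \<xi>(n) \<Lambda>(n) / n\<close>.
\<close>

section \<open>Dirichlet characters\<close>

text \<open>The exponent in \<open>p ^ p\<close> is what makes the hypothesis strong: the order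
  \<open>k\<close> of \<open>n\<close> modulo \<open>q\<close> divides \<open>q - 1\<close>, so
  \<open>q\<close> and \<open>k\<close> are coprime, and the residue of the base modulo
  \<open>q\<close> and that of the exponent modulo \<open>k\<close> can be prescribed independently.
  The obstacle is that a prime has to meet both conditions; hence the long analytic part, whose
  result is used again to treat conjugate roots of unity. The bound on the order turns into a
  contradiction as follows. A prime \<open>q\<close> dividing a value \<open>g n\<close> of the
  minimal polynomial also divides \<open>f n\<close>; so either \<open>q\<close> divides
  \<open>n\<close>, or the order of \<open>n\<close> divides \<open>L\<close>, and in both cases
  \<open>q\<close> divides \<open>n * (n ^ L - 1)\<close>. A Bezout identity between
  \<open>g\<close> and \<open>X * (X ^ L - 1)\<close> then puts \<open>q\<close> among the divisors
  of a fixed nonzero integer, which Schur's theorem avoids. On the analytic side each character sum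
  is shown to be \<open>c * ln N + O(1)\<close> with \<open>c\<close> equal to 1, 0 or -1. The value
  -1 belongs to a vanishing \<open>L(1)\<close> and could cancel the main term, so it has to be
  excluded.\<close>

locale dcharacter =
  fixes m :: nat and \<xi> :: "nat \<Rightarrow> complex"
  assumes modulus_pos: "m > 0"
    and mult: "\<xi> (a * b) = \<xi> a * \<xi> b"
    and cong: "[a = b] (mod m) \<Longrightarrow> \<xi> a = \<xi> b"
    and eq_0_iff: "\<xi> a = 0 \<longleftrightarrow> \<not> coprime a m"
begin

lemma one [simp]: "\<xi> 1 = 1" "\<xi> (Suc 0) = 1"
proof -
  have "\<xi> 1 * \<xi> 1 = \<xi> 1" using mult[of 1 1] by simp
  moreover have "\<xi> 1 \<noteq> 0" by (subst eq_0_iff) simp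
  ultimately show "\<xi> 1 = 1" by simp
  then show "\<xi> (Suc 0) = 1" by simp
qed

lemma power: "\<xi> (a ^ k) = \<xi> a ^ k"
  by (induction k) (simp_all add: mult)

lemma power_totient: "coprime a m \<Longrightarrow> \<xi> a ^ totient m = 1"
  using cong[OF euler_theorem[of a m]] by (simp add: power)

lemma norm_eq_1: "coprime a m \<Longrightarrow> norm (\<xi> a) = 1"
proof -
  assume "coprime a m"
  then have "norm (\<xi> a) ^ totient m = 1 ^ totient m"
    using power_totient by (simp flip: norm_power)
  then show ?thesis
    using modulus_pos by (intro power_eq_imp_eq_base[of _ "totient m" 1]) auto
qed

lemma norm_le_1: "norm (\<xi> a) \<le> 1"
  using norm_eq_1[of a] eq_0_iff[of a] by (cases "coprime a m") auto

lemma add_modulus: "\<xi> (n + m) = \<xi> n"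
  by (rule cong) (simp add: unique_euclidean_semiring_class.cong_def)

end

definition dcharacters :: "nat \<Rightarrow> (nat \<Rightarrow> complex) set" where
  "dcharacters m = {\<xi>. dcharacter m \<xi>}"

definition principal_char :: "nat \<Rightarrow> nat \<Rightarrow> complex" where
  "principal_char m n = (if coprime n m then 1 else 0)"

lemma principal_char_in: "m > 0 \<Longrightarrow> principal_char m \<in> dcharacters m"
  unfolding dcharacters_def dcharacter_def principal_char_def
  by (auto dest: cong_imp_coprime cong_imp_coprime[OF cong_sym])

lemma dcharacters_mult:
  "\<xi> \<in> dcharacters m \<Longrightarrow> \<psi> \<in> dcharacters m \<Longrightarrow> (\<lambda>n. \<xi> n * \<psi> n) \<in> dcharacters m"
  unfolding dcharacters_def dcharacter_def by auto

lemma dcharacters_cnj: "\<xi> \<in> dcharacters m \<Longrightarrow> (\<lambda>n. cnj (\<xi> n)) \<in> dcharacters m"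
  unfolding dcharacters_def dcharacter_def by auto

lemma finite_dcharacters:
  assumes "m > 0" shows "finite (dcharacters m)"
proof -
  define Z where "Z = insert 0 {z::complex. z ^ totient m = 1}"
  have "finite {z::complex. z ^ totient m = 1}"
    using finite_nth_roots[of "totient m" 1] assms by simp
  then have fin: "finite (PiE {..<m} (\<lambda>_. Z))"
    by (intro finite_PiE) (auto simp: Z_def)
  have "(\<lambda>\<xi>. restrict \<xi> {..<m}) ` dcharacters m \<subseteq> PiE {..<m} (\<lambda>_. Z)"
    by (intro image_subsetI restrict_PiE_iff[THEN iffD2] ballI)
       (auto simp: Z_def dcharacters_def dcharacter.eq_0_iff dcharacter.power_totient)
  moreover have "inj_on (\<lambda>\<xi>. restrict \<xi> {..<m}) (dcharacters m)"
  proof (rule inj_onI)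
    fix \<xi> \<psi> assume *: "\<xi> \<in> dcharacters m" "\<psi> \<in> dcharacters m"
      and eq: "restrict \<xi> {..<m} = restrict \<psi> {..<m}"
    show "\<xi> = \<psi>"
    proof
      fix n
      have "\<xi> n = \<xi> (n mod m)" "\<psi> n = \<psi> (n mod m)"
        using * unfolding dcharacters_def by (auto intro: dcharacter.cong)
      moreover have "restrict \<xi> {..<m} (n mod m) = restrict \<psi> {..<m} (n mod m)"
        using eq by simp
      ultimately show "\<xi> n = \<psi> n" using assms by simp
    qed
  qed
  ultimately show ?thesis
    using fin finite_imageD finite_subset by blast
qed

text \<open>A character of a subgroup of the units modulo \<open>m\<close>, with the subgroup
  encoded as a union of residue classes of naturals. Closure under products is enough for a subgroup
  because the unit group is finite.\<close>

definition partial_char :: "nat \<Rightarrow> nat set \<Rightarrow> (nat \<Rightarrow> complex) \<Rightarrow> bool" where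
  "partial_char m H \<xi> \<longleftrightarrow> 1 \<in> H \<and>
     (\<forall>a\<in>H. coprime a m \<and> \<xi> a \<noteq> 0) \<and>
     (\<forall>a\<in>H. \<forall>b\<in>H. a * b \<in> H \<and> \<xi> (a * b) = \<xi> a * \<xi> b) \<and>
     (\<forall>a b. [a = b] (mod m) \<longrightarrow> a \<in> H \<longrightarrow> b \<in> H \<and> \<xi> a = \<xi> b)"

lemma partial_charD:
  assumes "partial_char m H \<xi>"
  shows "1 \<in> H" "a \<in> H \<Longrightarrow> coprime a m" "a \<in> H \<Longrightarrow> \<xi> a \<noteq> 0"
    "a \<in> H \<Longrightarrow> b \<in> H \<Longrightarrow> a * b \<in> H" "a \<in> H \<Longrightarrow> b \<in> H \<Longrightarrow> \<xi> (a * b) = \<xi> a * \<xi> b"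
    "[a = b] (mod m) \<Longrightarrow> a \<in> H \<Longrightarrow> b \<in> H" "[a = b] (mod m) \<Longrightarrow> a \<in> H \<Longrightarrow> \<xi> a = \<xi> b"
  using assms unfolding partial_char_def by blast+

lemma partial_char_power:
  assumes "partial_char m H \<xi>" "a \<in> H"
  shows "a ^ k \<in> H \<and> \<xi> (a ^ k) = \<xi> a ^ k"
proof (induction k)
  case 0
  have "\<xi> 1 * \<xi> 1 = \<xi> 1" "\<xi> 1 \<noteq> 0"
    using partial_charD(5)[OF assms(1), of 1 1] partial_charD(1,3)[OF assms(1)] by auto
  then show ?case using partial_charD(1)[OF assms(1)] by simp
next
  case (Suc k)
  then show ?case using partial_charD(4,5)[OF assms(1) assms(2), of "a ^ k"] by simp
qed

text \<open>By Euler's theorem the power \<open>a ^ (totient m - 1)\<close> is an inverse of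
  \<open>a\<close> inside \<open>H\<close>.\<close>

lemma partial_char_cancel:
  assumes "partial_char m H \<xi>" "a \<in> H" "a * u \<in> H" "m > 0"
  shows "u \<in> H"
proof -
  have "a * u * a ^ (totient m - 1) \<in> H"
    using assms partial_charD(4) partial_char_power by blast
  moreover have "a * u * a ^ (totient m - 1) = a ^ totient m * u"
    using \<open>m > 0\<close> by (cases "totient m") (auto simp: mult_ac)
  moreover have "[a ^ totient m * u = 1 * u] (mod m)"
    using partial_charD(2)[OF assms(1,2)] by (intro cong_mult euler_theorem) auto
  ultimately show ?thesis using partial_charD(6)[OF assms(1), of _ u] by (simp only: mult_1)
qed

lemma exists_nth_root_ne_1:
  fixes w :: complex
  assumes "k \<ge> 2" "w \<noteq> 0"
  shows "\<exists>z. z ^ k = w \<and> z \<noteq> 1"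
proof (cases "w = 1")
  case True
  have "card {z::complex. z ^ k = 1} = k" using card_roots_unity_eq assms by simp
  then have "\<not> {z::complex. z ^ k = 1} \<subseteq> {1}"
    using card_mono[of "{1}" "{z::complex. z ^ k = 1}"] assms by auto
  then show ?thesis using True by auto
next
  case False
  have "card {z::complex. z ^ k = w} = k" using card_nth_roots assms by simp
  then have "{z::complex. z ^ k = w} \<noteq> {}" using assms by (intro notI) simp
  then obtain z where "z ^ k = w" by auto
  then show ?thesis using False by (intro exI[of _ z]) auto
qed

text \<open>If \<open>k\<close> is the least positive exponent with \<open>x ^ k \<in> H\<close>,
  the only constraint on the value \<open>z\<close> at \<open>x\<close> is
  \<open>z ^ k = \<xi> (x ^ k)\<close>. Since \<open>x \<notin> H\<close> forces
  \<open>k \<ge> 2\<close>, there is a choice of \<open>z\<close> other than 1, which is what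
  separating residues requires.\<close>

lemma partial_char_extend:
  assumes pc: "partial_char m H \<xi>" and m: "m > 0" and x: "coprime x m" "x \<notin> H"
  shows "\<exists>H' \<psi>. partial_char m H' \<psi> \<and> H \<subseteq> H' \<and> x \<in> H' \<and> (\<forall>a\<in>H. \<psi> a = \<xi> a) \<and> \<psi> x \<noteq> 1"
proof -
  note D = partial_charD[OF pc]
  have \<xi>1: "\<xi> 1 = 1" using partial_char_power[OF pc D(1), of 0] by simp
  define k where "k = (LEAST k. k > 0 \<and> x ^ k \<in> H)"
  have "[x ^ totient m = 1] (mod m)" using x(1) by (rule euler_theorem)
  then have "x ^ totient m \<in> H" using D(1,6) cong_sym by blast
  then have "totient m > 0 \<and> x ^ totient m \<in> H" using m by simp
  from LeastI[of "\<lambda>k. k > 0 \<and> x ^ k \<in> H", OF this]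
  have k: "k > 0" "x ^ k \<in> H" by (auto simp: k_def)
  have kleast: "\<And>j. 0 < j \<Longrightarrow> j < k \<Longrightarrow> x ^ j \<notin> H"
    unfolding k_def using not_less_Least by blast
  have "k \<noteq> 1" using k x(2) by auto
  then have "k \<ge> 2" using k by simp
  then obtain z where z: "z ^ k = \<xi> (x ^ k)" "z \<noteq> 1"
    using exists_nth_root_ne_1 D(3)[OF k(2)] by metis
  \<comment> \<open>Minimality makes \<open>k\<close> divide every \<open>j\<close> with
    \<open>x ^ j \<in> H\<close>.\<close>
  have zpow: "\<xi> (x ^ j) = z ^ j" if "x ^ j \<in> H" for j
  proof -
    have "x ^ (j mod k) \<in> H"
    proof (rule partial_char_cancel[OF pc _ _ m])
      show "(x ^ k) ^ (j div k) \<in> H" using partial_char_power[OF pc k(2)] by blast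
      show "(x ^ k) ^ (j div k) * x ^ (j mod k) \<in> H"
        using that by (simp flip: power_mult power_add)
    qed
    then have "j mod k = 0" using kleast[of "j mod k"] k(1) by (cases "j mod k = 0") auto
    then have "j = k * (j div k)" by auto
    then have "\<xi> (x ^ j) = \<xi> ((x ^ k) ^ (j div k))" "z ^ j = (z ^ k) ^ (j div k)"
      by (metis power_mult, metis power_mult)
    then show ?thesis using partial_char_power[OF pc k(2)] z by simp
  qed
  have uniq0: "\<xi> h * z ^ i = \<xi> h' * z ^ j"
    if h: "h \<in> H" "h' \<in> H" "[h * x ^ i = h' * x ^ j] (mod m)" "i \<le> j" for h h' i j
  proof -
    have "[x ^ i * h = x ^ i * (h' * x ^ (j - i))] (mod m)"
      using h(3,4) by (simp add: mult_ac flip: power_add)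
    then have c: "[h = h' * x ^ (j - i)] (mod m)"
      using x(1) cong_mult_lcancel_nat[of "x ^ i" m] by (simp add: coprime_power_left_iff)
    then have "h' * x ^ (j - i) \<in> H" using D(6) h(1) by blast
    then have *: "x ^ (j - i) \<in> H" using partial_char_cancel[OF pc h(2) _ m] by blast
    have "\<xi> h = \<xi> h' * z ^ (j - i)"
      using D(7)[OF c h(1)] D(5)[OF h(2) *] zpow[OF *] by simp
    then show ?thesis using h(4) by (simp add: mult.assoc flip: power_add)
  qed
  have uniq: "\<xi> h * z ^ i = \<xi> h' * z ^ j"
    if h: "h \<in> H" "h' \<in> H" "[h * x ^ i = h' * x ^ j] (mod m)" for h h' i j
    using uniq0[OF h] uniq0[OF h(2,1) cong_sym[OF h(3)]] by (cases "i \<le> j") auto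
  \<comment> \<open>\<open>R\<close> is the graph of the extension
    \<open>h * x ^ i \<mapsto> \<xi> h * z ^ i\<close>; \<open>uniq\<close> makes it single-valued,
    and working up to congruence makes its domain a union of residue classes.\<close>
  define R where "R = (\<lambda>n w. \<exists>h i. h \<in> H \<and> [n = h * x ^ i] (mod m) \<and> w = \<xi> h * z ^ i)"
  define H' where "H' = {n. \<exists>w. R n w}"
  define \<psi> where "\<psi> = (\<lambda>n. THE w. R n w)"
  have Runiq: "w = w'" if R: "R n w" "R n w'" for n w w'
  proof -
    obtain h i h' j where *: "h \<in> H" "[n = h * x ^ i] (mod m)" "w = \<xi> h * z ^ i"
      "h' \<in> H" "[n = h' * x ^ j] (mod m)" "w' = \<xi> h' * z ^ j"
      using R unfolding R_def by blast
    show ?thesis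
      using uniq[OF *(1,4) cong_trans[OF cong_sym[OF *(2)] *(5)]] *(3,6) by simp
  qed
  have Rcong: "R b w" if "R a w" "[a = b] (mod m)" for a b w
    using that(1) cong_trans[OF cong_sym[OF that(2)]] unfolding R_def by blast
  have \<psi>I: "\<psi> n = w" if "R n w" for n w
    unfolding \<psi>_def using that Runiq by (intro the_equality) blast+
  have R\<psi>: "R n (\<psi> n)" if "n \<in> H'" for n
    using that \<psi>I unfolding H'_def by blast
  have Rmult: "R (a * b) (v * w)" if ab: "R a v" "R b w" for a b v w
  proof -
    obtain h i where 1: "h \<in> H" "[a = h * x ^ i] (mod m)" "v = \<xi> h * z ^ i"
      using ab(1) unfolding R_def by blast
    obtain h' j where 2: "h' \<in> H" "[b = h' * x ^ j] (mod m)" "w = \<xi> h' * z ^ j"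
      using ab(2) unfolding R_def by blast
    have "[a * b = (h * h') * x ^ (i + j)] (mod m)"
      using cong_mult[OF 1(2) 2(2)] by (simp add: power_add mult_ac)
    moreover have "v * w = \<xi> (h * h') * z ^ (i + j)"
      using 1(3) 2(3) D(5)[OF 1(1) 2(1)] by (simp add: power_add)
    ultimately show ?thesis unfolding R_def using D(4)[OF 1(1) 2(1)] by blast
  qed
  have z0: "z \<noteq> 0" using z(1)[symmetric] D(3)[OF k(2)] k(1) by (auto simp: zero_power)
  have Rgood: "coprime n m \<and> w \<noteq> 0" if nw: "R n w" for n w
  proof -
    obtain h i where 1: "h \<in> H" "[n = h * x ^ i] (mod m)" "w = \<xi> h * z ^ i"
      using nw unfolding R_def by blast
    have "coprime (h * x ^ i) m" using D(2)[OF 1(1)] x(1) by simp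
    then show ?thesis using 1 z0 D(3)[OF 1(1)] cong_imp_coprime[OF cong_sym[OF 1(2)]] by simp
  qed
  have RH: "R a (\<xi> a)" if "a \<in> H" for a
    unfolding R_def using that by (intro exI[of _ a] exI[of _ 0]) auto
  have Rx: "R x z"
    unfolding R_def using D(1) \<xi>1 by (intro exI[of _ 1] exI[of _ "1::nat"]) auto
  have "partial_char m H' \<psi>"
    unfolding partial_char_def
  proof (intro conjI ballI allI impI)
    show "1 \<in> H'" using RH[OF D(1)] by (auto simp: H'_def)
  next
    fix a assume "a \<in> H'"
    from Rgood[OF R\<psi>[OF this]] show "coprime a m" "\<psi> a \<noteq> 0" by auto
  next
    fix a b assume "a \<in> H'" "b \<in> H'"
    from Rmult[OF this[THEN R\<psi>]] have "R (a * b) (\<psi> a * \<psi> b)" .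
    then show "a * b \<in> H'" "\<psi> (a * b) = \<psi> a * \<psi> b" using \<psi>I by (auto simp: H'_def)
  next
    fix a b assume "[a = b] (mod m)" "a \<in> H'"
    then have "R b (\<psi> a)" using Rcong R\<psi> by blast
    then show "b \<in> H'" "\<psi> a = \<psi> b" using \<psi>I by (auto simp: H'_def)
  qed
  moreover have "H \<subseteq> H'" using RH unfolding H'_def by blast
  moreover have "x \<in> H'" using Rx unfolding H'_def by blast
  moreover have "\<forall>a\<in>H. \<psi> a = \<xi> a" using RH \<psi>I by blast
  moreover have "\<psi> x \<noteq> 1" using Rx \<psi>I z(2) by blast
  ultimately show ?thesis by blast
qed

text \<open>Each extension step removes a residue from \<open>{..<m} - H\<close>. Once
  \<open>H\<close> contains all units, the value 0 elsewhere gives a Dirichlet character.\<close>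

lemma partial_char_extend_full:
  assumes "partial_char m H \<xi>" "m > 0"
  shows "\<exists>\<psi>\<in>dcharacters m. \<forall>a\<in>H. \<psi> a = \<xi> a"
  using assms
proof (induction "card ({..<m} - H)" arbitrary: H \<xi> rule: less_induct)
  case less
  note D = partial_charD[OF less.prems(1)]
  show ?case
  proof (cases "\<forall>x. coprime x m \<longrightarrow> x \<in> H")
    case True
    then have H: "x \<in> H \<longleftrightarrow> coprime x m" for x using D(2) by blast
    define \<psi> where "\<psi> = (\<lambda>n. if n \<in> H then \<xi> n else 0)"
    have "dcharacter m \<psi>"
    proof
      show "m > 0" by fact
      show "\<psi> (a * b) = \<psi> a * \<psi> b" for a b
        using D(5)[of a b] by (auto simp: \<psi>_def H)
      show "\<psi> a = \<psi> b" if "[a = b] (mod m)" for a b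
        using D(6,7)[OF that] D(6)[OF cong_sym[OF that]] by (auto simp: \<psi>_def)
      show "\<psi> a = 0 \<longleftrightarrow> \<not> coprime a m" for a
        using D(3)[of a] by (auto simp: \<psi>_def H)
    qed
    then show ?thesis by (intro bexI[of _ \<psi>]) (auto simp: \<psi>_def dcharacters_def)
  next
    case False
    then obtain x where x: "coprime x m" "x \<notin> H" by blast
    obtain H' \<psi> where H': "partial_char m H' \<psi>" "H \<subseteq> H'" "x \<in> H'" "\<forall>a\<in>H. \<psi> a = \<xi> a"
      using partial_char_extend[OF less.prems x] by blast
    have "x mod m \<notin> H" using D(6)[of "x mod m" x] x(2) by auto
    moreover have "x mod m \<in> H'"
      using partial_charD(6)[OF H'(1) _ H'(3), of "x mod m"] by (simp add: cong_def)
    ultimately have "{..<m} - H' \<subset> {..<m} - H" using H'(2) less.prems(2) by auto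
    then have "card ({..<m} - H') < card ({..<m} - H)" by (intro psubset_card_mono) auto
    from less.hyps[OF this H'(1) less.prems(2)] obtain \<phi> where "\<phi> \<in> dcharacters m" "\<forall>a\<in>H'. \<phi> a = \<psi> a" by blast
    then show ?thesis using H'(2,4) by (intro bexI[of _ \<phi>]) auto
  qed
qed

section \<open>Separation of residues and orthogonality of characters\<close>

lemma dcharacters_separate:
  assumes "m > 0" "coprime c m" "\<not> [c = 1] (mod m)"
  shows "\<exists>\<xi>\<in>dcharacters m. \<xi> c \<noteq> 1"
proof -
  \<comment> \<open>The starting point is the trivial character on the class of 1; as
    \<open>c\<close> lies outside that class, the extension can take a value other than 1
    there.\<close>
  define H where "H = {n. [n = 1] (mod m)}"
  have "partial_char m H (\<lambda>_. 1)"
    unfolding partial_char_def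
  proof (intro conjI ballI allI impI)
    show "a * b \<in> H" if "a \<in> H" "b \<in> H" for a b
      using cong_mult[of a 1 m b 1] that by (simp add: H_def)
    show "coprime a m" if "a \<in> H" for a
      using cong_imp_coprime[of 1 a m] that by (simp add: H_def cong_sym_eq)
    show "b \<in> H" if "[a = b] (mod m)" "a \<in> H" for a b
      using cong_trans[OF cong_sym[OF that(1)]] that(2) by (simp add: H_def)
  qed (auto simp: H_def)
  from partial_char_extend[OF this assms(1,2)] assms(3) obtain H' \<psi>
    where H': "partial_char m H' \<psi>" "c \<in> H'" "\<psi> c \<noteq> 1" by (auto simp: H_def)
  from partial_char_extend_full[OF H'(1) assms(1)] obtain \<phi>
    where "\<phi> \<in> dcharacters m" "\<forall>a\<in>H'. \<phi> a = \<psi> a" by blast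
  then show ?thesis using H'(2,3) by (intro bexI[of _ \<phi>]) auto
qed

text \<open>Multiplication by a character \<open>\<psi>\<close> with
  \<open>\<psi> c \<noteq> 1\<close> permutes the characters, with multiplication by the conjugate
  as inverse, so the sum equals \<open>\<psi> c\<close> times itself.\<close>

lemma sum_dcharacters:
  assumes "m > 0" "coprime c m"
  shows "(\<Sum>\<xi>\<in>dcharacters m. \<xi> c) = (if [c = 1] (mod m) then of_nat (card (dcharacters m)) else 0)"
proof (cases "[c = 1] (mod m)")
  case True
  then have "\<xi> c = 1" if "\<xi> \<in> dcharacters m" for \<xi>
    using that dcharacter.cong[of m \<xi> c 1] dcharacter.one by (auto simp: dcharacters_def)
  then have "(\<Sum>\<xi>\<in>dcharacters m. \<xi> c) = (\<Sum>\<xi>\<in>dcharacters m. 1)"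
    by (intro sum.cong) auto
  then show ?thesis using True by simp
next
  case False
  obtain \<psi> where \<psi>: "\<psi> \<in> dcharacters m" "\<psi> c \<noteq> 1" using dcharacters_separate[OF assms False] by blast
  interpret \<psi>: dcharacter m \<psi> using \<psi> by (simp add: dcharacters_def)
  have cancel: "cnj (\<psi> n) * (\<psi> n * w) = w" if "coprime n m" for n w
  proof -
    have "\<psi> n * cnj (\<psi> n) = 1"
      using \<psi>.norm_eq_1[OF that] complex_norm_square[of "\<psi> n"] by simp
    then have "cnj (\<psi> n) * \<psi> n = 1" by (simp only: mult.commute)
    then show ?thesis by (simp only: mult.assoc[symmetric] mult_1)
  qed
  have zero: "\<xi> n = 0" if "\<xi> \<in> dcharacters m" "\<not> coprime n m" for \<xi> n
    using that by (simp add: dcharacters_def dcharacter.eq_0_iff)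
  have c1: "cnj (\<psi> n) * (\<psi> n * \<xi> n) = \<xi> n" "\<psi> n * (cnj (\<psi> n) * \<xi> n) = \<xi> n"
    if "\<xi> \<in> dcharacters m" for \<xi> n
    using cancel[of n "\<xi> n"] zero[OF that, of n]
    by (cases "coprime n m"; simp add: mult.left_commute)+
  have "(\<Sum>\<xi>\<in>dcharacters m. \<xi> c) = (\<Sum>\<xi>\<in>dcharacters m. \<psi> c * \<xi> c)"
    by (rule sum.reindex_bij_witness[of _ "\<lambda>\<xi> n. \<psi> n * \<xi> n" "\<lambda>\<xi> n. cnj (\<psi> n) * \<xi> n"])
       (auto simp: c1 intro!: dcharacters_mult[OF \<psi>(1)] dcharacters_mult[OF dcharacters_cnj[OF \<psi>(1)]])
  also have "\<dots> = \<psi> c * (\<Sum>\<xi>\<in>dcharacters m. \<xi> c)" by (rule sum_distrib_left[symmetric])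
  finally have "(1 - \<psi> c) * (\<Sum>\<xi>\<in>dcharacters m. \<xi> c) = 0"
    by (simp only: left_diff_distrib) simp
  then show ?thesis using \<psi>(2) False by auto
qed

text \<open>\<open>c'\<close> is an inverse of \<open>c\<close> modulo \<open>m\<close>, so
  \<open>\<xi> c'\<close> stands for the conjugate of \<open>\<xi> c\<close>.\<close>

lemma dcharacters_orthogonality:
  assumes "m > 0" "coprime c m"
  shows "\<exists>c'. coprime c' m \<and> (\<forall>n. (\<Sum>\<xi>\<in>dcharacters m. \<xi> c' * \<xi> n) =
                (if [n = c] (mod m) then of_nat (card (dcharacters m)) else 0))"
proof -
  define c' where "c' = c ^ (totient m - 1)"
  have cc: "[c' * c = 1] (mod m)"
    using euler_theorem[OF assms(2)] assms(1) unfolding c'_def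
    by (cases "totient m") (auto simp: mult_ac)
  have cop: "coprime c' m" using assms(2) by (simp add: c'_def)
  have "(\<Sum>\<xi>\<in>dcharacters m. \<xi> c' * \<xi> n) =
          (if [n = c] (mod m) then of_nat (card (dcharacters m)) else 0)" for n
  proof (cases "coprime n m")
    case True
    have iff: "[c' * n = 1] (mod m) \<longleftrightarrow> [n = c] (mod m)"
      using cc cong_mult_lcancel_nat[OF cop, of n c] by (meson cong_sym cong_trans)
    have "(\<Sum>\<xi>\<in>dcharacters m. \<xi> c' * \<xi> n) = (\<Sum>\<xi>\<in>dcharacters m. \<xi> (c' * n))"
      by (intro sum.cong) (auto simp: dcharacters_def dcharacter.mult)
    also have "\<dots> = (if [c' * n = 1] (mod m) then of_nat (card (dcharacters m)) else 0)"
      using cop True by (intro sum_dcharacters assms(1)) auto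
    finally show ?thesis by (simp only: iff)
  next
    case False
    then have "\<not> [n = c] (mod m)" using assms(2) cong_imp_coprime cong_sym by blast
    moreover have "(\<Sum>\<xi>\<in>dcharacters m. \<xi> c' * \<xi> n) = 0"
      using False by (intro sum.neutral) (auto simp: dcharacters_def dcharacter.eq_0_iff)
    ultimately show ?thesis by simp
  qed
  then show ?thesis using cop by blast
qed

section \<open>Estimates of Chebyshev and Mertens\<close>

text \<open>Both sides run over the pairs of positive \<open>d\<close>, \<open>e\<close> with
  \<open>d * e \<le> N\<close>.\<close>

lemma sum_divisors_swap:
  fixes f :: "nat \<Rightarrow> nat \<Rightarrow> 'a :: comm_monoid_add"
  shows "(\<Sum>n=1..N. \<Sum>d | d dvd n. f d (n div d)) = (\<Sum>d=1..N. \<Sum>e=1..N div d. f d e)"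
proof -
  have "(\<Sum>n=1..N. \<Sum>d | d dvd n. f d (n div d)) =
          (\<Sum>(n, d)\<in>(SIGMA n:{1..N}. {d. d dvd n}). f d (n div d))"
    by (rule sum.Sigma) auto
  also have "\<dots> = (\<Sum>(d, e)\<in>(SIGMA d:{1..N}. {1..N div d}). f d e)"
  proof (rule sum.reindex_bij_witness[of _ "\<lambda>(d, e). (d * e, d)" "\<lambda>(n, d). (d, n div d)"], goal_cases)
    case (4 x)
    obtain d e where x: "x = (d, e)" by (cases x)
    then have *: "1 \<le> d" "1 \<le> e" "e \<le> N div d" using 4 by auto
    then have "d * e \<le> N"
      by (metis div_times_less_eq_dividend le_trans mult.commute mult_le_mono2)
    then show ?case using * x by auto
  next
    case (2 x)
    obtain n d where x: "x = (n, d)" by (cases x)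
    then have *: "1 \<le> n" "n \<le> N" "d dvd n" using 2 by auto
    then have "d > 0" "d \<le> N" "n div d \<le> N div d"
      by (auto intro: Nat.gr0I dvd_imp_le div_le_mono dest: dvd_imp_le)
    moreover have "n div d \<ge> 1" using * by (simp add: Suc_le_eq dvd_imp_le div_greater_zero_iff \<open>d > 0\<close>)
    ultimately show ?case using x by auto
  qed auto
  also have "\<dots> = (\<Sum>d=1..N. \<Sum>e=1..N div d. f d e)"
    by (rule sum.Sigma[symmetric]) auto
  finally show ?thesis .
qed

lemma ln_fact_eq_sum_mangoldt:
  "ln (fact N) = (\<Sum>d=1..N. mangoldt d * real (N div d))"
proof -
  have "ln (fact N) = (\<Sum>n=1..N. ln (real n))"
    by (subst ln_prod[symmetric]) (auto simp: fact_prod)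
  also have "\<dots> = (\<Sum>n=1..N. \<Sum>d | d dvd n. mangoldt d)"
    by (intro sum.cong refl) (simp add: mangoldt_sum)
  also have "\<dots> = (\<Sum>d=1..N. \<Sum>e=1..N div d. mangoldt d)"
    by (rule sum_divisors_swap)
  finally show ?thesis by (simp add: mult.commute)
qed

lemma ln_fact_ge: "N \<ge> 1 \<Longrightarrow> ln (fact N) \<ge> real N * ln (real N) - real N"
proof (induction N rule: nat_induct_at_least)
  case (Suc N)
  have "ln (1 + 1 / real N) \<le> 1 / real N" using Suc.hyps by (intro ln_add_one_self_le_self) auto
  moreover have "1 + 1 / real N = real (Suc N) / real N" using Suc.hyps by (simp add: field_simps)
  ultimately have "ln (real (Suc N)) - ln (real N) \<le> 1 / real N"
    using Suc.hyps by (simp add: ln_div)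
  then have "real N * (ln (real (Suc N)) - ln (real N)) \<le> 1"
    using Suc.hyps by (simp add: field_simps)
  moreover have "ln (fact (Suc N)) = ln (real (Suc N)) + ln (fact N)"
    by (simp add: ln_mult)
  ultimately show ?case using Suc.IH by (simp add: algebra_simps)
qed auto

lemma ln_fact_le: "N \<ge> 1 \<Longrightarrow> ln (fact N) \<le> real N * ln (real N)"
proof -
  assume "N \<ge> 1"
  have "ln (fact N) \<le> ln (real (N ^ N))"
    using fact_le_power[of N, where 'a = real] \<open>N \<ge> 1\<close> by (subst ln_le_cancel_iff) auto
  then show ?thesis using \<open>N \<ge> 1\<close> by (simp add: ln_realpow)
qed

text \<open>Chebyshev's argument: \<open>(2 * N) choose N\<close> is at most
  \<open>2 ^ (2 * N)\<close>, and in its logarithm \<open>mangoldt d\<close> has the coefficient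
  \<open>2 * N div d - 2 * (N div d)\<close>, which is nonnegative and at least 1 for
  \<open>N < d \<le> 2 * N\<close>.\<close>

lemma sum_mangoldt_double:
  "(\<Sum>d=1..2*N. mangoldt d :: real) \<le> (\<Sum>d=1..N. mangoldt d) + 2 * real N * ln 2"
proof -
  have "(fact (2 * N) :: real) = fact N * fact N * real ((2 * N) choose N)"
    using binomial_fact_lemma[of N "2 * N"] by (metis diff_mult_distrib le_add1 mult_2 add_diff_cancel_right' of_nat_fact of_nat_mult)
  then have "ln (fact (2 * N)) = 2 * ln (fact N) + ln (real ((2 * N) choose N))"
    by (simp add: ln_mult)
  moreover have "ln (real ((2 * N) choose N)) \<le> ln (2 ^ (2 * N))"
    using binomial_le_pow2[of "2 * N" N] zero_less_binomial[of N "2 * N"]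
    by (subst ln_le_cancel_iff) (auto simp flip: of_nat_le_iff)
  ultimately have 1: "ln (fact (2 * N)) - 2 * ln (fact N) \<le> 2 * real N * ln 2"
    by (simp add: ln_realpow)
  have "(\<Sum>d=1..N. mangoldt d * real (N div d)) = (\<Sum>d=1..2*N. mangoldt d * real (N div d))"
    by (intro sum.mono_neutral_left) auto
  then have "ln (fact (2 * N)) - 2 * ln (fact N :: real) =
      (\<Sum>d=1..2*N. mangoldt d * (real (2 * N div d) - 2 * real (N div d)))"
    unfolding ln_fact_eq_sum_mangoldt
    by (simp add: sum_subtractf sum_distrib_left algebra_simps)
  also have "\<dots> \<ge> (\<Sum>d=1..2*N. if d \<le> N then 0 else mangoldt d)"
  proof (intro sum_mono)
    fix d assume d: "d \<in> {1..2 * N}"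
    have "2 * (N div d) \<le> 2 * N div d"
    proof -
      have "2 * (N div d) * d \<le> 2 * N"
        using mult_le_mono2[OF div_times_less_eq_dividend[of N d], of 2] by (simp only: mult.assoc)
      then show ?thesis using d by (simp add: less_eq_div_iff_mult_less_eq)
    qed
    moreover have "2 * N div d \<ge> 1" using d by (simp add: Suc_le_eq div_greater_zero_iff)
    ultimately have "real (2 * N div d) - 2 * real (N div d) \<ge> (if d \<le> N then 0 else 1)"
      by auto
    then show "(if d \<le> N then 0 else mangoldt d) \<le> mangoldt d * (real (2 * N div d) - 2 * real (N div d))"
      using mult_left_mono[OF \<open>(if d \<le> N then 0 else 1) \<le> real (2 * N div d) - 2 * real (N div d)\<close> mangoldt_nonneg[of d]]
      by (cases "d \<le> N") (simp_all only: if_True if_False mult_zero_right mult_1_right)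
  qed
  finally have 2: "ln (fact (2 * N)) - 2 * ln (fact N :: real) \<ge> (\<Sum>d=1..2*N. if d \<le> N then 0 else mangoldt d)" .
  have "(\<Sum>d=1..2*N. mangoldt d :: real) =
     (\<Sum>d=1..2*N. (if d \<le> N then mangoldt d else 0) + (if d \<le> N then 0 else mangoldt d))"
    by (intro sum.cong) auto
  also have "\<dots> = (\<Sum>d=1..2*N. (if d \<le> N then mangoldt d else 0)) + (\<Sum>d=1..2*N. if d \<le> N then 0 else mangoldt d)"
    by (rule sum.distrib)
  also have "(\<Sum>d=1..2*N. (if d \<le> N then mangoldt d else 0)) = (\<Sum>d=1..N. mangoldt d :: real)"
    by (rule sum.mono_neutral_cong_right) auto
  finally show ?thesis using 1 2 by linarith
qed

text \<open>The constant 4 survives halving: \<open>4 * k\<close> from the induction and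
  \<open>2 * k * ln 2 \<le> 2 * k\<close> give \<open>6 * k\<close> at \<open>2 * k\<close>, and an
  odd \<open>N = 2 * k + 1\<close> adds at most \<open>N - 1 = 2 * k\<close>.\<close>

lemma sum_mangoldt_le: "(\<Sum>d=1..N. mangoldt d :: real) \<le> 4 * real N"
proof (induction N rule: less_induct)
  case (less N)
  have ln2: "ln (2::real) \<le> 1" using ln_le_minus_one[of "2::real"] by simp
  show ?case
  proof (cases "N = 0")
    case False
    define k where "k = N div 2"
    have "k < N" using False by (simp add: k_def)
    have k: "(\<Sum>d=1..2*k. mangoldt d :: real) \<le> 6 * real k"
      using sum_mangoldt_double[of k] less.IH[OF \<open>k < N\<close>] mult_left_mono[OF ln2, of "2 * real k"] by simp
    consider "N = 2 * k" | "N = Suc (2 * k)" unfolding k_def by linarith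
    then show ?thesis
    proof cases
      case 1
      then show ?thesis using k by simp
    next
      case 2
      have "mangoldt N \<le> ln (real N)" by (rule mangoldt_le) (use 2 in simp)
      also have "\<dots> \<le> real N - 1" using ln_le_minus_one[of "real N"] False by simp
      finally have "mangoldt N \<le> 2 * real k" using 2 by simp
      then show ?thesis using k 2 by simp
    qed
  qed simp
qed

text \<open>Mertens: \<open>ln (fact N)\<close> weights \<open>mangoldt d\<close> by
  \<open>N div d\<close>. Passing to \<open>N / d\<close> costs at most \<open>mangoldt d\<close>
  for each \<open>d\<close>, hence \<open>4 * N\<close> in all, which becomes a constant after
  division by \<open>N\<close>.\<close>

lemma sum_mangoldt_over_le:
  assumes "N \<ge> 1" shows "(\<Sum>d=1..N. mangoldt d / real d) \<le> ln (real N) + 4"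
proof -
  have "(\<Sum>d=1..N. mangoldt d / real d) * real N = (\<Sum>d=1..N. mangoldt d * (real N / real d))"
    by (simp add: sum_distrib_right)
  also have "\<dots> \<le> (\<Sum>d=1..N. mangoldt d * (real (N div d) + 1))"
  proof (intro sum_mono mult_left_mono mangoldt_nonneg)
    fix d assume "d \<in> {1..N}"
    have "N \<le> d * (N div d) + d" using dividend_less_times_div[of d N] \<open>d \<in> _\<close> by simp
    then have "real N \<le> real d * real (N div d) + real d" by (metis of_nat_add of_nat_le_iff of_nat_mult)
    then show "real N / real d \<le> real (N div d) + 1" using \<open>d \<in> _\<close> by (simp add: field_simps)
  qed
  also have "\<dots> = ln (fact N) + (\<Sum>d=1..N. mangoldt d)"
    by (simp add: ln_fact_eq_sum_mangoldt distrib_left sum.distrib)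
  also have "\<dots> \<le> real N * ln (real N) + 4 * real N"
    using ln_fact_le[OF assms] sum_mangoldt_le[of N] by simp
  finally have "(\<Sum>d=1..N. mangoldt d / real d) * real N \<le> (ln (real N) + 4) * real N"
    by (simp add: algebra_simps)
  then show ?thesis using assms by (subst (asm) mult_le_cancel_right_pos) auto
qed

lemma sum_mangoldt_over_ge:
  assumes "N \<ge> 1" shows "(\<Sum>d=1..N. mangoldt d / real d) \<ge> ln (real N) - 1"
proof -
  have "(ln (real N) - 1) * real N \<le> ln (fact N)"
    using ln_fact_ge[OF assms] by (simp add: algebra_simps)
  also have "\<dots> \<le> (\<Sum>d=1..N. mangoldt d * (real N / real d))"
    unfolding ln_fact_eq_sum_mangoldt
  proof (intro sum_mono mult_left_mono mangoldt_nonneg)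
    fix d assume "d \<in> {1..N}"
    then show "real (N div d) \<le> real N / real d" by (simp add: of_nat_div_le_of_nat)
  qed
  also have "\<dots> = (\<Sum>d=1..N. mangoldt d / real d) * real N"
    by (simp add: sum_distrib_right)
  finally show ?thesis using assms by (subst (asm) mult_le_cancel_right_pos) auto
qed

text \<open>The weights \<open>ln (N / d)\<close> are bounded on average; this keeps a further
  logarithm out of the error when \<open>L = 0\<close>.\<close>

lemma sum_ln_div_le: "N \<ge> 1 \<Longrightarrow> (\<Sum>d=1..N. ln (real N / real d)) \<le> real N"
proof -
  assume N: "N \<ge> 1"
  have "(\<Sum>d=1..N. ln (real N / real d)) = (\<Sum>d=1..N. ln (real N) - ln (real d))"
    by (intro sum.cong) (auto simp: ln_div)
  also have "\<dots> = real N * ln (real N) - ln (fact N)"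
  proof -
    have "ln (fact N) = (\<Sum>d=1..N. ln (real d))"
      by (subst ln_prod[symmetric]) (auto simp: fact_prod)
    then show ?thesis by (simp add: sum_subtractf)
  qed
  finally show ?thesis using ln_fact_ge[OF N] by linarith
qed

section \<open>The Moebius function\<close>

definition moebius :: "nat \<Rightarrow> real" where
  "moebius n = (if squarefree n then (-1) ^ card (prime_factors n) else 0)"

lemma abs_moebius_le: "\<bar>moebius n\<bar> \<le> 1"
  by (simp add: moebius_def power_abs)

lemma moebius_prime_mult:
  assumes "prime p" "\<not> p dvd d" "d > 0"
  shows "moebius (p * d) = - moebius d"
proof -
  have "coprime p d" using assms prime_imp_coprime by blast
  then have "squarefree (p * d) \<longleftrightarrow> squarefree d"
    using assms(1) squarefree_mult_coprime squarefree_multD(2) squarefree_prime by blast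
  moreover have "prime_factors (p * d) = insert p (prime_factors d)"
    using assms by (subst prime_factors_product) (auto simp: prime_factorization_prime)
  moreover have "p \<notin> prime_factors d" using assms by auto
  ultimately show ?thesis by (simp add: moebius_def)
qed

text \<open>For a prime \<open>p\<close> dividing \<open>n\<close>, the squarefree divisors
  \<open>d\<close> prime to \<open>p\<close> cancel against the divisors
  \<open>p * d\<close>.\<close>

lemma sum_moebius: "n > 0 \<Longrightarrow> (\<Sum>d | d dvd n. moebius d) = (if n = 1 then 1 else 0)"
proof (cases "n = 1")
  case False
  assume n: "n > 0"
  obtain p where p: "prime p" "p dvd n" using prime_factor_nat False by blast
  define A where "A = {d. d dvd n \<and> \<not> p dvd d}"
  define B where "B = {d. d dvd n \<and> p dvd d \<and> squarefree d}"
  have fin: "finite {d. d dvd n}" using n by simp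
  have "(\<Sum>d\<in>B. moebius d) = (\<Sum>d\<in>{d\<in>A. squarefree d}. - moebius d)"
  proof (rule sum.reindex_bij_witness[of _ "\<lambda>d. p * d" "\<lambda>d. d div p"])
    fix d assume "d \<in> B"
    then obtain e where d: "d = p * e" "d dvd n" "squarefree d" by (auto simp: B_def elim: dvdE)
    have e: "\<not> p dvd e"
    proof
      assume "p dvd e"
      then have "p ^ 2 dvd d" using d(1) by (auto simp: power2_eq_square)
      then have "is_unit p" using d(3) unfolding squarefree_def by blast
      then show False using p(1) by auto
    qed
    have "squarefree e" using d(1,3) squarefree_multD(2) by blast
    then show "d div p \<in> {d\<in>A. squarefree d}"
      using d e p n prime_gt_0_nat[OF p(1)] by (auto simp: A_def dest: dvd_mult_right)
    show "p * (d div p) = d" using d by simp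
    have "e > 0" using d n by (cases "e = 0") auto
    then show "- moebius (d div p) = moebius d"
      using moebius_prime_mult[OF p(1) e] d(1) prime_gt_0_nat[OF p(1)] by simp
  next
    fix d assume d: "d \<in> {d\<in>A. squarefree d}"
    then have c: "coprime p d" using p(1) prime_imp_coprime by (auto simp: A_def)
    then show "p * d \<in> B" using d p by (auto simp: A_def B_def divides_mult squarefree_mult_coprime squarefree_prime)
    show "p * d div p = d" using prime_gt_0_nat[OF p(1)] by simp
  qed
  also have "\<dots> = - (\<Sum>d\<in>A. moebius d)"
    unfolding sum_negf using finite_subset[OF _ fin, of A]
    by (intro arg_cong[of _ _ uminus] sum.mono_neutral_left) (auto simp: A_def moebius_def)
  finally have "(\<Sum>d\<in>A. moebius d) + (\<Sum>d\<in>B. moebius d) = 0" by simp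
  moreover have "(\<Sum>d | d dvd n. moebius d) = (\<Sum>d\<in>A \<union> B. moebius d)"
    by (rule sum.mono_neutral_right[OF fin]) (auto simp: A_def B_def moebius_def)
  moreover have "(\<Sum>d\<in>A \<union> B. moebius d) = (\<Sum>d\<in>A. moebius d) + (\<Sum>d\<in>B. moebius d)"
    using finite_subset[OF _ fin, of A] finite_subset[OF _ fin, of B]
    by (intro sum.union_disjoint) (auto simp: A_def B_def)
  ultimately show ?thesis using False by simp
qed (simp add: moebius_def)

lemma dvd_div_swap:
  fixes a b n :: nat
  assumes "n > 0" "a dvd n" "b dvd n div a"
  shows "b dvd n" "a dvd n div b"
proof -
  obtain c where "n div a = b * c" using assms(3) by (elim dvdE)
  then have n: "n = a * (b * c)" using assms(2) by (metis dvd_mult_div_cancel)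
  then show "b dvd n" by simp
  have "b > 0" using n assms(1) by (cases "b = 0") auto
  then have "n div b = a * c" using n by (simp add: mult.left_commute)
  then show "a dvd n div b" by simp
qed

text \<open>Moebius inversion of \<open>mangoldt_sum\<close>: after swapping the order of summation,
  the inner sum over the divisors of \<open>n div e\<close> is nonzero only for
  \<open>e = n\<close>.\<close>

lemma sum_moebius_ln:
  assumes "n > 0"
  shows "(\<Sum>d | d dvd n. moebius d * ln (real (n div d))) = mangoldt n"
proof -
  have fin: "finite {d. d dvd n}" using assms by simp
  have fin': "finite {e. e dvd n div d}" if "d dvd n" for d
    using that assms by (auto intro!: finite_divisors_nat Nat.gr0I simp: dvd_div_eq_0_iff)
  have "(\<Sum>d | d dvd n. moebius d * ln (real (n div d))) =
     (\<Sum>d | d dvd n. \<Sum>e | e dvd n div d. moebius d * mangoldt e)"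
    using assms by (intro sum.cong) (auto simp: sum_distrib_left[symmetric] mangoldt_sum dvd_div_eq_0_iff)
  also have "\<dots> = (\<Sum>(d, e)\<in>(SIGMA d:{d. d dvd n}. {e. e dvd n div d}). moebius d * mangoldt e)"
    using fin fin' by (intro sum.Sigma) auto
  also have "\<dots> = (\<Sum>(e, d)\<in>(SIGMA e:{e. e dvd n}. {d. d dvd n div e}). moebius d * mangoldt e)"
    using assms
    by (intro sum.reindex_bij_witness[of _ "\<lambda>(a, b). (b, a)" "\<lambda>(a, b). (b, a)"])
       (auto dest: dvd_div_swap)
  also have "\<dots> = (\<Sum>e | e dvd n. \<Sum>d | d dvd n div e. moebius d * mangoldt e)"
    using fin fin' by (intro sum.Sigma[symmetric]) auto
  also have "\<dots> = (\<Sum>e | e dvd n. (if e = n then 1 else 0) * mangoldt e)"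
  proof (intro sum.cong refl)
    fix e assume "e \<in> {e. e dvd n}"
    then have "n div e > 0" "n div e = 1 \<longleftrightarrow> e = n"
      using assms by (auto simp: dvd_div_eq_0_iff elim!: dvdE intro!: Nat.gr0I)
    then show "(\<Sum>d | d dvd n div e. moebius d * mangoldt e) = (if e = n then 1 else 0) * mangoldt e"
      using sum_moebius[of "n div e"] by (simp flip: sum_distrib_right)
  qed
  also have "\<dots> = (\<Sum>e\<in>{n}. (if e = n then 1 else 0) * mangoldt e)"
    using fin by (intro sum.mono_neutral_right) auto
  finally show ?thesis by simp
qed

section \<open>Contribution of the proper prime powers\<close>

lemma sum_power_le:
  fixes x :: real
  assumes "0 \<le> x" "x \<le> 1 / 2" "N \<ge> 2"
  shows "(\<Sum>k=2..N. x ^ k) \<le> 2 * x\<^sup>2"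
proof -
  \<comment> \<open>The term \<open>- x ^ N\<close> makes the bound inductive: the step needs just
    \<open>2 * x ^ Suc N \<le> x ^ N\<close>.\<close>
  have "(\<Sum>k=2..N. x ^ k) \<le> 2 * x\<^sup>2 - x ^ N"
    using assms(3)
  proof (induction N rule: nat_induct_at_least)
    case (Suc N)
    have "2 * x * x ^ N \<le> 1 * x ^ N" using assms by (intro mult_right_mono) auto
    then show ?case using Suc by simp
  qed simp
  then show ?thesis using zero_le_power[OF assms(1), of N] by linarith
qed

lemma sum_mangoldt_nonprime_bounded:
  "\<exists>C. \<forall>N. (\<Sum>n\<in>{n\<in>{1..N}. \<not> prime n}. mangoldt n / real n) \<le> C"
proof -
  \<comment> \<open>The product of \<open>ln p \<le> 2 * sqrt p\<close> and of the bound
    \<open>2 / p ^ 2\<close> for the geometric sum over the exponents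
    \<open>k \<ge> 2\<close>.\<close>
  define a where "a = (\<lambda>p::nat. 4 * real p powr (-3/2))"
  have summ: "summable a" unfolding a_def
    by (intro summable_mult) (simp add: summable_real_powr_iff)
  have "(\<Sum>n\<in>{n\<in>{1..N}. \<not> prime n}. mangoldt n / real n) \<le> suminf a" for N
  proof -
    let ?I = "{p\<in>{2..N}. prime p} \<times> {2..N}"
    have "(\<Sum>n\<in>{n\<in>{1..N}. \<not> prime n}. mangoldt n / real n) =
          (\<Sum>n\<in>{n\<in>{1..N}. \<not> prime n \<and> primepow n}. mangoldt n / real n)"
      by (rule sum.mono_neutral_right) (auto simp: mangoldt_def)
    also have "\<dots> \<le> (\<Sum>n\<in>(\<lambda>(p, k). p ^ k) ` ?I. mangoldt n / real n)"
    proof (rule sum_mono2)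
      show "{n\<in>{1..N}. \<not> prime n \<and> primepow n} \<subseteq> (\<lambda>(p, k). p ^ k) ` ?I"
      proof safe
        fix n assume n: "n \<in> {1..N}" "\<not> prime n" "primepow n"
        obtain p k where pk: "prime p" "k > 0" "n = p ^ k" using n(3) by (auto simp: primepow_def)
        then have "k \<noteq> 1" using n(2) by auto
        moreover have "k < p ^ k" using power_gt_expt[of p k] prime_gt_1_nat[OF pk(1)] by simp
        moreover have "p \<le> p ^ k" using self_le_power[of p k] prime_ge_1_nat[OF pk(1)] pk(2) by simp
        ultimately have "(p, k) \<in> ?I" using pk n(1) prime_ge_2_nat[OF pk(1)] by auto
        then show "n \<in> (\<lambda>(p, k). p ^ k) ` ?I" using pk(3) by force
      qed
    qed (auto simp: mangoldt_nonneg)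
    also have "\<dots> \<le> (\<Sum>(p, k)\<in>?I. mangoldt (p ^ k) / real (p ^ k))"
      by (rule order.trans[OF sum_image_le]) (auto simp: mangoldt_nonneg case_prod_unfold o_def)
    also have "\<dots> = (\<Sum>p\<in>{p\<in>{2..N}. prime p}. \<Sum>k=2..N. mangoldt (p ^ k) / real (p ^ k))"
      by (rule sum.cartesian_product[symmetric])
    also have "\<dots> \<le> (\<Sum>p\<in>{p\<in>{2..N}. prime p}. a p)"
    proof (rule sum_mono)
      fix p assume "p \<in> {p\<in>{2..N}. prime p}"
      then have p: "prime p" "p \<ge> 2" "N \<ge> 2" by auto
      have "(\<Sum>k=2..N. mangoldt (p ^ k) / real (p ^ k)) = ln (real p) * (\<Sum>k=2..N. (1 / real p) ^ k)"
        using p by (simp add: sum_distrib_left power_one_over field_simps)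
      also have "\<dots> \<le> (2 * sqrt (real p)) * (2 * (1 / real p)\<^sup>2)"
      proof (intro mult_mono)
        have "ln (sqrt (real p)) \<le> sqrt (real p)"
          using ln_le_minus_one[of "sqrt (real p)"] p(2) by simp
        then show "ln (real p) \<le> 2 * sqrt (real p)" using p(2) by (simp add: ln_sqrt)
        show "(\<Sum>k=2..N. (1 / real p) ^ k) \<le> 2 * (1 / real p)\<^sup>2"
          using sum_power_le[of "1 / real p" N] p by (simp add: field_simps)
      qed (auto intro!: sum_nonneg)
      also have "\<dots> = a p"
      proof -
        have "sqrt (real p) / (real p)\<^sup>2 = real p powr (1/2) / real p powr 2"
          using p(2) by (simp add: powr_half_sqrt)
        also have "\<dots> = real p powr (1/2 - 2)" by (rule powr_diff[symmetric])
        also have "1/2 - 2 = (-3/2 :: real)" by simp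
        finally have "4 * (sqrt (real p) / (real p)\<^sup>2) = a p" by (simp only: a_def)
        then show ?thesis by (simp add: power_one_over field_simps)
      qed
      finally show "(\<Sum>k=2..N. mangoldt (p ^ k) / real (p ^ k)) \<le> a p" .
    qed
    also have "\<dots> \<le> suminf a"
      using summ by (intro sum_le_suminf) (auto simp: a_def)
    finally show ?thesis .
  qed
  then show ?thesis by blast
qed

section \<open>The value of L-series at 1\<close>

text \<open>Abel summation: the partial sums \<open>F\<close> are bounded by \<open>B\<close>, and
  the nonnegative decrements of \<open>g\<close> telescope, so the total weight of \<open>B\<close>
  is \<open>g a\<close>.\<close>

lemma norm_sum_moebiuslt_antimono_le:
  fixes f :: "nat \<Rightarrow> complex" and g :: "nat \<Rightarrow> real"
  assumes bound: "\<And>k. norm (\<Sum>n=a..<k. f n) \<le> B"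
    and nonneg: "\<And>n. n \<ge> a \<Longrightarrow> g n \<ge> 0"
    and antimono: "\<And>n. n \<ge> a \<Longrightarrow> g (Suc n) \<le> g n"
    and "a \<le> b"
  shows "norm (\<Sum>n=a..<b. of_real (g n) * f n) \<le> B * g a"
proof -
  define F where "F = (\<lambda>k. \<Sum>n=a..<k. f n)"
  have eq: "(\<Sum>n=a..<b. of_real (g n) * f n) =
          F b * of_real (g b) + (\<Sum>n=a..<b. F (Suc n) * of_real (g n - g (Suc n)))"
    using \<open>a \<le> b\<close>
    by (induction b rule: dec_induct) (simp_all add: F_def algebra_simps)
  have "norm (\<Sum>n=a..<b. F (Suc n) * of_real (g n - g (Suc n))) \<le> (\<Sum>n=a..<b. B * (g n - g (Suc n)))"
  proof (rule sum_norm_le)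
    fix n assume "n \<in> {a..<b}"
    then have *: "g n - g (Suc n) \<ge> 0" using antimono[of n] by simp
    have "norm (F (Suc n)) * (g n - g (Suc n)) \<le> B * (g n - g (Suc n))"
      using * unfolding F_def by (rule mult_right_mono[OF bound])
    then show "norm (F (Suc n) * of_real (g n - g (Suc n))) \<le> B * (g n - g (Suc n))"
      using * by (simp add: norm_mult del: of_real_diff)
  qed
  also have "\<dots> = B * (g a - g b)"
    using \<open>a \<le> b\<close> by (induction b rule: dec_induct) (simp_all add: algebra_simps)
  finally have 1: "norm (\<Sum>n=a..<b. F (Suc n) * of_real (g n - g (Suc n))) \<le> B * (g a - g b)" .
  have 2: "norm (F b * of_real (g b)) \<le> B * g b"
    using bound nonneg[OF \<open>a \<le> b\<close>] unfolding F_def by (simp add: norm_mult mult_right_mono)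
  show ?thesis
    unfolding eq using norm_triangle_mono[OF 2 1] by (simp add: algebra_simps)
qed

text \<open>\<open>ln x / x\<close> decreases only beyond \<open>exp 1\<close>, whence the 3: there
  \<open>ln n \<ge> 1\<close>, so the increment of \<open>ln\<close> is at most
  \<open>1 / n \<le> ln n / n\<close>.\<close>

lemma ln_over_self_antimono:
  assumes "n \<ge> 3"
  shows "ln (real (Suc n)) / real (Suc n) \<le> ln (real n) / real n"
proof -
  have "1 \<le> ln (real n)"
    using exp_le assms by (subst ln_ge_iff) (auto intro: order.trans)
  moreover have "ln (1 + 1 / real n) \<le> 1 / real n" using assms by (intro ln_add_one_self_le_self) auto
  moreover have "1 + 1 / real n = real (Suc n) / real n" using assms by (simp add: field_simps)
  ultimately have "ln (real (Suc n)) - ln (real n) \<le> ln (real n) / real n"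
    using assms by (simp add: ln_div field_simps)
  then show ?thesis using assms by (simp add: field_simps)
qed

text \<open>The partial sums of the series that formally represents \<open>- L' / L\<close> at
  1.\<close>

definition mangoldt_char_sum :: "(nat \<Rightarrow> complex) \<Rightarrow> nat \<Rightarrow> complex" where
  "mangoldt_char_sum \<xi> N = (\<Sum>n=1..N. \<xi> n * of_real (mangoldt n / real n))"

locale nonprincipal_dcharacter = dcharacter +
  assumes nonprincipal: "\<exists>a. coprime a m \<and> \<xi> a \<noteq> 1"
begin

lemma sum_period: "(\<Sum>n<m. \<xi> n) = 0"
proof -
  obtain a where a: "coprime a m" "\<xi> a \<noteq> 1" using nonprincipal by blast
  have inj: "inj_on (\<lambda>n. a * n mod m) {..<m}"
  proof (rule inj_onI)
    fix x y assume xy: "x \<in> {..<m}" "y \<in> {..<m}" "a * x mod m = a * y mod m"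
    then have "[a * x = a * y] (mod m)" by (simp add: unique_euclidean_semiring_class.cong_def)
    then have "[x = y] (mod m)" using a(1) cong_mult_lcancel_nat by blast
    then show "x = y" using xy cong_less_modulus_unique_nat by auto
  qed
  have "(\<lambda>n. a * n mod m) ` {..<m} = {..<m}"
    using modulus_pos by (intro endo_inj_surj inj) auto
  then have "(\<Sum>n<m. \<xi> n) = (\<Sum>n\<in>(\<lambda>n. a * n mod m) ` {..<m}. \<xi> n)" by simp
  also have "\<dots> = (\<Sum>n<m. \<xi> (a * n mod m))" by (subst sum.reindex[OF inj]) (simp add: o_def)
  also have "\<dots> = (\<Sum>n<m. \<xi> a * \<xi> n)"
  proof (intro sum.cong refl)
    fix n
    have "\<xi> (a * n mod m) = \<xi> (a * n)" by (intro cong) simp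
    then show "\<xi> (a * n mod m) = \<xi> a * \<xi> n" by (simp only: mult)
  qed
  also have "\<dots> = \<xi> a * (\<Sum>n<m. \<xi> n)" by (rule sum_distrib_left[symmetric])
  finally have "(1 - \<xi> a) * (\<Sum>n<m. \<xi> n) = 0" by (simp only: left_diff_distrib) simp
  then show ?thesis using a(2) by simp
qed

text \<open>Full periods contribute 0, and fewer than \<open>m\<close> terms of norm at most 1
  remain.\<close>

lemma norm_sum_lessThan_le: "norm (\<Sum>n<N. \<xi> n) \<le> real m"
proof (induction N rule: less_induct)
  case (less N)
  show ?case
  proof (cases "N < m")
    case True
    have "norm (\<Sum>n<N. \<xi> n) \<le> (\<Sum>n<N. 1)" by (intro sum_norm_le norm_le_1)
    then show ?thesis using True by simp
  next
    case False
    then have N: "N = m + (N - m)" by simp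
    have "(\<Sum>n<m + (N - m). \<xi> n) = (\<Sum>n<m. \<xi> n) + (\<Sum>n=m..<m + (N - m). \<xi> n)"
      using sum.atLeastLessThan_concat[of 0 m "m + (N - m)" \<xi>] by (simp add: lessThan_atLeast0)
    also have "(\<Sum>n=m..<m + (N - m). \<xi> n) = (\<Sum>n<N - m. \<xi> (n + m))"
      using sum.shift_bounds_nat_ivl[of \<xi> 0 m "N - m"] by (simp add: lessThan_atLeast0 add.commute)
    also have "\<dots> = (\<Sum>n<N - m. \<xi> n)" by (simp add: add_modulus)
    finally show ?thesis using less.IH[of "N - m"] modulus_pos False N sum_period by simp
  qed
qed

lemma norm_sum_interval_le: "norm (\<Sum>n=a..<b. \<xi> n) \<le> 2 * real m"
proof (cases "a \<le> b")
  case True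
  then have "(\<Sum>n=a..<b. \<xi> n) = (\<Sum>n<b. \<xi> n) - (\<Sum>n<a. \<xi> n)"
    using sum.atLeastLessThan_concat[of 0 a b \<xi>] by (simp add: lessThan_atLeast0 algebra_simps)
  then show ?thesis
    using norm_triangle_ineq4[of "\<Sum>n<b. \<xi> n" "\<Sum>n<a. \<xi> n"]
      norm_sum_lessThan_le[of a] norm_sum_lessThan_le[of b] by simp
qed simp

section \<open>Convergence of the L-series at 1 and Mertens estimates with characters\<close>

definition S :: "nat \<Rightarrow> complex" where
  "S N = (\<Sum>n=1..N. \<xi> n / of_nat n)"

lemma S_diff_le:
  assumes "M \<le> N" shows "norm (S N - S M) \<le> 2 * real m / real (Suc M)"
proof -
  have "S N - S M = (\<Sum>n=Suc M..<Suc N. \<xi> n / of_nat n)"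
    using sum.atLeastLessThan_concat[of 1 "Suc M" "Suc N" "\<lambda>n. \<xi> n / of_nat n"] assms
    by (simp add: S_def atLeastLessThanSuc_atLeastAtMost algebra_simps)
  also have "\<dots> = (\<Sum>n=Suc M..<Suc N. of_real (1 / real n) * \<xi> n)" by simp
  also have "norm \<dots> \<le> 2 * real m * (1 / real (Suc M))"
    using assms by (intro norm_sum_moebiuslt_antimono_le norm_sum_interval_le) (auto simp: field_simps)
  finally show ?thesis by simp
qed

definition L :: complex where "L = lim S"

lemma S_tendsto: "S \<longlonglongrightarrow> L"
proof -
  have "Cauchy S"
  proof (rule metric_CauchyI)
    fix e :: real assume "e > 0"
    obtain M where M: "real M > 2 * real m / e" using reals_Archimedean2 by blast
    have *: "norm (S k - S n) < e" if "k \<ge> M" "n \<ge> k" for k n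
    proof -
      have "norm (S n - S k) \<le> 2 * real m / real (Suc k)" using S_diff_le that by simp
      also have "\<dots> < e"
      proof -
        have "2 * real m < e * real M" using M \<open>e > 0\<close> by (simp add: field_simps)
        also have "\<dots> \<le> e * real (Suc k)" using that \<open>e > 0\<close> by (intro mult_left_mono) auto
        finally show ?thesis by (simp add: field_simps)
      qed
      finally show ?thesis by (simp add: norm_minus_commute)
    qed
    have "dist (S k) (S n) < e" if "k \<ge> M" "n \<ge> M" for k n
      using *[of k n] *[of n k] that by (cases "k \<le> n") (auto simp: dist_norm norm_minus_commute)
    then show "\<exists>M. \<forall>k\<ge>M. \<forall>n\<ge>M. dist (S k) (S n) < e" by blast
  qed
  then show ?thesis unfolding L_def using Cauchy_convergent convergent_LIMSEQ_iff by blast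
qed

lemma L_diff_le: "norm (L - S M) \<le> 2 * real m / real (Suc M)"
proof (rule tendsto_upperbound)
  show "(\<lambda>N. norm (S N - S M)) \<longlonglongrightarrow> norm (L - S M)" by (intro tendsto_intros S_tendsto)
  show "\<forall>\<^sub>F N in sequentially. norm (S N - S M) \<le> 2 * real m / real (Suc M)"
    using eventually_ge_at_top[of M] by eventually_elim (rule S_diff_le)
qed simp

text \<open>Because \<open>N < d * Suc (N div d)\<close>, the factor \<open>1 / d\<close> and a tail
  of the L-series after \<open>N div d\<close> combine to O(1 / N) uniformly in \<open>d\<close>.
  Errors thus stay bounded whenever the weights \<open>w\<close> sum to O(N).\<close>

lemma weighted_error_le:
  assumes "d \<in> {1..N}" "w \<ge> 0" "norm z \<le> 2 * real m / real (Suc (N div d))"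
  shows "norm (\<xi> d * of_real (w / real d) * z) \<le> 2 * real m * w / real N"
proof -
  have "N < d * Suc (N div d)"
    using dividend_less_times_div[of d N] assms(1) by simp
  then have "real N \<le> real d * real (Suc (N div d))" by (metis less_imp_le of_nat_le_iff of_nat_mult)
  then have *: "1 / (real d * real (Suc (N div d))) \<le> 1 / real N"
    using assms(1) by (intro divide_left_mono) auto
  have "norm (\<xi> d * of_real (w / real d) * z) \<le> (1 * (w / real d)) * (2 * real m / real (Suc (N div d)))"
    unfolding norm_mult using assms(2,3) norm_le_1[of d]
    by (intro mult_mono) (simp_all add: norm_divide)
  also have "\<dots> = 2 * real m * w * (1 / (real d * real (Suc (N div d))))" by simp
  also have "\<dots> \<le> 2 * real m * w * (1 / real N)"
    using * assms(2) by (intro mult_left_mono) auto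
  finally show ?thesis by simp
qed

text \<open>Complete multiplicativity splits \<open>\<xi> n / n\<close> at every divisor of
  \<open>n\<close>. The weights used are \<open>mangoldt\<close>, whose divisor sum is
  \<open>ln n\<close>, and \<open>moebius d * ln (N / d)\<close>.\<close>

lemma sum_convolution:
  "(\<Sum>n=1..N. \<xi> n / of_nat n * of_real (\<Sum>d | d dvd n. w d)) =
     (\<Sum>d=1..N. \<xi> d * of_real (w d / real d) * S (N div d))"
proof -
  have "(\<Sum>n=1..N. \<xi> n / of_nat n * of_real (\<Sum>d | d dvd n. w d)) =
    (\<Sum>n=1..N. \<Sum>d | d dvd n. \<xi> d * of_real (w d / real d) * (\<xi> (n div d) / of_nat (n div d)))"
  proof (intro sum.cong refl)
    fix n assume n: "n \<in> {1..N}"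
    have "\<xi> n / of_nat n * of_real (\<Sum>d | d dvd n. w d) = (\<Sum>d | d dvd n. \<xi> n / of_nat n * of_real (w d))"
      by (simp add: sum_distrib_left)
    also have "\<dots> = (\<Sum>d | d dvd n. \<xi> d * of_real (w d / real d) * (\<xi> (n div d) / of_nat (n div d)))"
    proof (intro sum.cong refl)
      fix d assume "d \<in> {d. d dvd n}"
      then have nd: "n = d * (n div d)" by simp
      have "\<xi> n / of_nat n * of_real (w d) = \<xi> (d * (n div d)) / of_nat (d * (n div d)) * of_real (w d)"
        using nd by simp
      also have "\<dots> = \<xi> d * of_real (w d / real d) * (\<xi> (n div d) / of_nat (n div d))"
        by (simp only: mult of_nat_mult) simp
      finally show "\<xi> n / of_nat n * of_real (w d) =
          \<xi> d * of_real (w d / real d) * (\<xi> (n div d) / of_nat (n div d))" .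
    qed
    finally show "\<xi> n / of_nat n * of_real (\<Sum>d | d dvd n. w d) =
      (\<Sum>d | d dvd n. \<xi> d * of_real (w d / real d) * (\<xi> (n div d) / of_nat (n div d)))" .
  qed
  also have "\<dots> = (\<Sum>d=1..N. \<Sum>e=1..N div d. \<xi> d * of_real (w d / real d) * (\<xi> e / of_nat e))"
    by (rule sum_divisors_swap)
  finally show ?thesis by (simp add: S_def sum_distrib_left)
qed

text \<open>Abel summation applies from 3 on, where \<open>ln n / n\<close> decreases; the first two
  terms are estimated directly.\<close>

lemma sum_ln_bounded: "\<exists>B. \<forall>N. norm (\<Sum>n=1..N. \<xi> n / of_nat n * of_real (ln (real n))) \<le> B"
proof -
  let ?f = "\<lambda>n. \<xi> n / of_nat n * of_real (ln (real n))"
  have "norm (\<Sum>n=1..N. ?f n) \<le> 2 * ln 2 + 2 * real m * (ln 3 / 3)" for N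
  proof -
    have small: "norm (\<Sum>n\<in>A. ?f n) \<le> 2 * ln 2" if "A \<subseteq> {1, 2}" for A
    proof -
      have "norm (?f n) \<le> ln 2" if "n \<in> {1, 2}" for n
      proof -
        have "norm (?f n) = norm (\<xi> n) * (ln (real n) / real n)"
          using that by (auto simp: norm_mult norm_divide)
        also have "\<dots> \<le> 1 * (ln (real n) / real n)"
          using that by (intro mult_right_mono norm_le_1) auto
        also have "\<dots> \<le> ln 2" using that by auto
        finally show ?thesis .
      qed
      then have "norm (\<Sum>n\<in>A. ?f n) \<le> (\<Sum>n\<in>A. ln 2)" using that by (intro sum_norm_le) auto
      also have "\<dots> \<le> 2 * ln 2"
        using card_mono[of "{1, 2::nat}" A] that by simp
      finally show ?thesis .
    qed
    show ?thesis
    proof (cases "N \<ge> 3")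
      case False
      then have "{1..N} \<subseteq> {1, 2}" by auto
      then have "norm (\<Sum>n=1..N. ?f n) \<le> 2 * ln 2" by (rule small)
      then show ?thesis using add_increasing2[of "2 * real m * (ln 3 / 3)"] by simp
    next
      case True
      then have "{1..N} = {1, 2} \<union> {3..<Suc N}" by auto
      then have "(\<Sum>n=1..N. ?f n) = (\<Sum>n\<in>{1,2}. ?f n) + (\<Sum>n=3..<Suc N. ?f n)"
        by (simp only:) (rule sum.union_disjoint; auto)
      also have "(\<Sum>n=3..<Suc N. ?f n) = (\<Sum>n=3..<Suc N. of_real (ln (real n) / real n) * \<xi> n)"
        by (rule sum.cong) (simp_all add: mult.commute)
      also have "norm ((\<Sum>n\<in>{1,2}. ?f n) + \<dots>) \<le> 2 * ln 2 + 2 * real m * (ln (real 3) / real 3)"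
        by (intro norm_triangle_mono small norm_sum_moebiuslt_antimono_le norm_sum_interval_le ln_over_self_antimono)
           (use True in auto)
      finally show ?thesis by simp
    qed
  qed
  then show ?thesis by blast
qed

text \<open>Replacing every \<open>S (N div d)\<close> by its limit in the convolution with
  \<open>mangoldt\<close> turns the sum into \<open>L * mangoldt_char_sum \<xi> N\<close>, at the
  cost \<open>2 * m / N * (4 * N) = 8 * m\<close>.\<close>

lemma mangoldt_char_sum_bounded:
  assumes "L \<noteq> 0" shows "\<exists>B. \<forall>N\<ge>1. norm (mangoldt_char_sum \<xi> N) \<le> B"
proof -
  obtain B where B: "\<And>N. norm (\<Sum>n=1..N. \<xi> n / of_nat n * of_real (ln (real n))) \<le> B"
    using sum_ln_bounded by blast
  have "norm (mangoldt_char_sum \<xi> N) \<le> (B + 8 * real m) / norm L" if N: "N \<ge> 1" for N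
  proof -
    have "(\<Sum>n=1..N. \<xi> n / of_nat n * of_real (ln (real n))) =
          (\<Sum>d=1..N. \<xi> d * of_real (mangoldt d / real d) * S (N div d))"
      using sum_convolution[where N = N and w = mangoldt] by (simp add: mangoldt_sum)
    then have eq: "L * mangoldt_char_sum \<xi> N = (\<Sum>n=1..N. \<xi> n / of_nat n * of_real (ln (real n))) +
        (\<Sum>d=1..N. \<xi> d * of_real (mangoldt d / real d) * (L - S (N div d)))"
      by (simp only: mangoldt_char_sum_def right_diff_distrib sum_subtractf sum_distrib_left) (simp add: mult_ac)
    have "norm (\<Sum>d=1..N. \<xi> d * of_real (mangoldt d / real d) * (L - S (N div d))) \<le>
        (\<Sum>d=1..N. 2 * real m * mangoldt d / real N)"
      by (intro sum_norm_le weighted_error_le L_diff_le mangoldt_nonneg) auto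
    also have "\<dots> = 2 * real m / real N * (\<Sum>d=1..N. mangoldt d)"
      by (simp add: sum_distrib_left)
    also have "\<dots> \<le> 2 * real m / real N * (4 * real N)"
      by (intro mult_left_mono sum_mangoldt_le) auto
    also have "\<dots> = 8 * real m" using N by simp
    finally have "norm (L * mangoldt_char_sum \<xi> N) \<le> B + 8 * real m"
      unfolding eq by (intro norm_triangle_mono B)
    then show ?thesis using assms by (simp add: norm_mult field_simps)
  qed
  then show ?thesis by blast
qed

text \<open>If \<open>L = 0\<close>, Moebius inversion with the weights \<open>ln (N / d)\<close> replaces the convolution with
  \<open>mangoldt\<close>: the only extra contribution is \<open>ln N\<close>, from \<open>n = 1\<close>.\<close>

lemma mangoldt_char_sum_plus_ln_bounded:
  assumes "L = 0" "N \<ge> 1"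
  shows "norm (mangoldt_char_sum \<xi> N + of_real (ln (real N))) \<le> 2 * real m"
proof -
  have inner: "(\<Sum>d | d dvd n. moebius d * ln (real N / real d)) = mangoldt n + (if n = 1 then ln (real N) else 0)"
    if n: "n \<in> {1..N}" for n
  proof -
    \<comment> \<open>\<open>ln (N / d) = ln (n / d) + ln (N / n)\<close>, and the second term is
      constant in \<open>d\<close>, so by \<open>sum_moebius\<close> it survives only at
      \<open>n = 1\<close>.\<close>
    have "(\<Sum>d | d dvd n. moebius d * ln (real N / real d)) =
       (\<Sum>d | d dvd n. moebius d * ln (real (n div d)) + moebius d * ln (real N / real n))"
    proof (intro sum.cong refl)
      fix d assume "d \<in> {d. d dvd n}"
      then have "d dvd n" "d > 0" using n by (auto intro: Nat.gr0I)
      then have "ln (real N / real d) = ln (real (n div d)) + ln (real N / real n)"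
        using n \<open>N \<ge> 1\<close> by (simp add: ln_div real_of_nat_div)
      then show "moebius d * ln (real N / real d) = moebius d * ln (real (n div d)) + moebius d * ln (real N / real n)"
        by (simp only: distrib_left)
    qed
    also have "\<dots> = mangoldt n + (if n = 1 then 1 else 0) * ln (real N / real n)"
      using n sum_moebius_ln[of n] sum_moebius[of n] by (simp only: sum.distrib flip: sum_distrib_right) auto
    finally show ?thesis by simp
  qed
  have "mangoldt_char_sum \<xi> N + of_real (ln (real N)) =
     (\<Sum>n=1..N. \<xi> n * of_real (mangoldt n / real n)) + (\<Sum>n=1..N. if n = 1 then of_real (ln (real N)) else 0)"
    using \<open>N \<ge> 1\<close> by (simp add: mangoldt_char_sum_def)
  also have "\<dots> = (\<Sum>n=1..N. \<xi> n / of_nat n * of_real (\<Sum>d | d dvd n. moebius d * ln (real N / real d)))"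
    unfolding sum.distrib[symmetric]
    by (intro sum.cong refl) (subst inner, auto simp: algebra_simps)
  also have "\<dots> = (\<Sum>d=1..N. \<xi> d * of_real (moebius d * ln (real N / real d) / real d) * S (N div d))"
    by (rule sum_convolution)
  \<comment> \<open>Since \<open>L = 0\<close>, each \<open>S (N div d)\<close> is itself a tail of
    the series.\<close>
  also have "norm \<dots> \<le> (\<Sum>d=1..N. 2 * real m * ln (real N / real d) / real N)"
  proof (rule sum_norm_le)
    fix d assume d: "d \<in> {1..N}"
    then have ln0: "ln (real N / real d) \<ge> 0" by simp
    have "norm (\<xi> d * of_real (moebius d * ln (real N / real d) / real d) * S (N div d)) =
       \<bar>moebius d\<bar> * norm (\<xi> d * of_real (ln (real N / real d) / real d) * S (N div d))"
      by (simp add: norm_mult norm_divide)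
    also have "\<dots> \<le> 1 * (2 * real m * ln (real N / real d) / real N)"
      using L_diff_le[of "N div d"] \<open>L = 0\<close> ln0
      by (intro mult_mono weighted_error_le d abs_moebius_le) auto
    finally show "norm (\<xi> d * of_real (moebius d * ln (real N / real d) / real d) * S (N div d))
       \<le> 2 * real m * ln (real N / real d) / real N" by simp
  qed
  also have "\<dots> = 2 * real m / real N * (\<Sum>d=1..N. ln (real N / real d))"
    by (simp add: sum_distrib_left)
  also have "\<dots> \<le> 2 * real m / real N * real N"
    using \<open>N \<ge> 1\<close> by (intro mult_left_mono sum_ln_div_le) auto
  finally show ?thesis using \<open>N \<ge> 1\<close> by simp
qed

end

text \<open>Monsky's proof that \<open>L(1) \<noteq> 0\<close> for real characters: if \<open>L(1) = 0\<close>, then the Lambert series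
  \<open>\<Sum> \<xi>(n) t\<^sup>n / (1 - t\<^sup>n)\<close> differs from \<open>-\<Sum> \<xi>(n) b(n)\<close> by a multiple of \<open>L(1)\<close>, so it stays bounded as
  \<open>t\<close> tends to 1; but its power series coefficients are nonnegative and at least 1 at every power
  of 4.\<close>

lemma lambert_weight_antimono:
  fixes t :: real and b :: "nat \<Rightarrow> real"
  assumes t: "0 < t" "t < 1"
  defines "b \<equiv> \<lambda>n. 1 / (real n * (1 - t)) - t ^ n / (1 - t ^ n)"
  assumes n: "n \<ge> 1"
  shows "b n \<ge> 0" "b (Suc n) \<le> b n"
proof -
  \<comment> \<open>\<open>u\<close> enters through the inequality of the arithmetic and geometric
    means: the terms \<open>i\<close> and \<open>k - 1 - i\<close> of \<open>s k\<close> have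
    product \<open>t ^ (k - 1)\<close>, hence sum at least \<open>2 * u ^ (k - 1)\<close>.\<close>
  define u where "u = sqrt t"
  have u: "0 < u" "u < 1" "u\<^sup>2 = t" using t by (auto simp: u_def)
  define s where "s = (\<lambda>n. \<Sum>i<n. t ^ i)"
  have s: "1 - t ^ k = (1 - t) * s k" for k
    unfolding s_def by (rule one_diff_power_eq)
  have sge: "s k \<ge> real k * u ^ (k - 1)" for k
  proof -
    have "s k = (\<Sum>i<k. t ^ (k - Suc i))" unfolding s_def by (rule sum.nat_diff_reindex[symmetric])
    then have "2 * s k = (\<Sum>i<k. t ^ i + t ^ (k - Suc i))" by (simp add: s_def sum.distrib)
    also have "\<dots> \<ge> (\<Sum>i<k. 2 * u ^ (k - 1))"
    proof (rule sum_mono)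
      fix i assume i: "i \<in> {..<k}"
      have "0 \<le> (u ^ i - u ^ (k - Suc i))\<^sup>2" by simp
      also have "\<dots> = t ^ i + t ^ (k - Suc i) - 2 * (u ^ i * u ^ (k - Suc i))"
        by (simp add: power2_diff u(3)[symmetric] flip: power_mult) (simp add: mult.commute power_mult)
      also have "u ^ i * u ^ (k - Suc i) = u ^ (k - 1)"
        using i by (simp flip: power_add)
      finally show "2 * u ^ (k - 1) \<le> t ^ i + t ^ (k - Suc i)" by simp
    qed
    finally show ?thesis by simp
  qed
  have spos: "s k > 0" if "k \<ge> 1" for k
    using sge[of k] u that by (smt (verit) mult_pos_pos of_nat_0_less_iff zero_less_power not_one_le_zero neq0_conv)
  have tu: "t ^ n = u ^ n * u ^ n" by (simp add: u(3)[symmetric] power2_eq_square power_mult_distrib)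
  have "real n * t ^ n \<le> s n"
  proof -
    have "t ^ n \<le> u ^ (n - 1)"
      unfolding u(3)[symmetric] power_mult[symmetric] using u by (intro power_decreasing) auto
    then show ?thesis using sge[of n] by (smt (verit) mult_left_mono of_nat_0_le_iff)
  qed
  then have "t ^ n / s n \<le> 1 / real n" using n spos[of n] by (simp add: field_simps)
  then have "t ^ n / s n / (1 - t) \<le> 1 / real n / (1 - t)" using t by (intro divide_right_mono) auto
  then show "b n \<ge> 0" by (simp add: b_def s mult.commute)
  \<comment> \<open>This compares decrements: from \<open>n\<close> to \<open>Suc n\<close> the two
    parts of \<open>b\<close> drop by \<open>1 / (n * Suc n)\<close> and
    \<open>t ^ n / (s n * s (Suc n))\<close>, both divided by \<open>1 - t\<close>.\<close>
  have le: "real n * real (Suc n) * t ^ n \<le> s n * s (Suc n)"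
  proof -
    have "real n * real (Suc n) * t ^ n \<le> real n * u ^ (n - 1) * (real (Suc n) * u ^ n)"
    proof -
      have "u ^ n \<le> u ^ (n - 1)" using u by (intro power_decreasing) auto
      then have "real n * real (Suc n) * (u ^ n * u ^ n) \<le> real n * real (Suc n) * (u ^ (n - 1) * u ^ n)"
        using u by (intro mult_left_mono mult_right_mono) auto
      then show ?thesis by (simp only: tu mult_ac)
    qed
    also have "\<dots> \<le> s n * s (Suc n)"
      using sge[of n] sge[of "Suc n"] spos[OF n] u by (intro mult_mono) auto
    finally show ?thesis .
  qed
  have "t ^ n / (1 - t ^ n) - t ^ Suc n / (1 - t ^ Suc n) = t ^ n / (s n * s (Suc n)) / (1 - t)"
  proof -
    have "s n > 0" "s (Suc n) > 0" using spos n by auto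
    moreover have "s (Suc n) - t * s n = 1"
      using s[of n] by (simp add: s_def algebra_simps)
    moreover have "t ^ n / ((1 - t) * S) - t ^ Suc n / ((1 - t) * S') = t ^ n * (S' - t * S) / (S * S') / (1 - t)"
      if "S > 0" "S' > 0" for S S'
    proof -
      have "t ^ n / ((1 - t) * S) = t ^ n * S' / (S * S') / (1 - t)"
        "t ^ Suc n / ((1 - t) * S') = t ^ n * (t * S) / (S * S') / (1 - t)"
        using that by (simp_all add: mult_ac)
      then show ?thesis by (simp only: right_diff_distrib diff_divide_distrib)
    qed
    ultimately show ?thesis unfolding s by simp
  qed
  also have "\<dots> \<le> 1 / (real n * real (Suc n)) / (1 - t)"
  proof (intro divide_right_mono)
    have "T / C \<le> 1 / D" if "D * T \<le> C" "D > 0" "C > 0" for T C D :: real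
      using that by (simp add: field_simps)
    then show "t ^ n / (s n * s (Suc n)) \<le> 1 / (real n * real (Suc n))"
      using le spos[of n] spos[of "Suc n"] n by simp
  qed (use t in simp)
  also have "\<dots> = 1 / (real n * (1 - t)) - 1 / (real (Suc n) * (1 - t))"
  proof -
    have "1 / (real n * real (Suc n)) = 1 / real n - 1 / real (Suc n)"
      using n by (simp add: field_simps)
    then show ?thesis by (simp only: diff_divide_distrib divide_divide_eq_left)
  qed
  finally show "b (Suc n) \<le> b n" by (simp add: b_def)
qed

section \<open>Nonvanishing for real characters\<close>

locale real_dcharacter = nonprincipal_dcharacter +
  assumes real: "\<xi> n \<in> \<real>"
begin

definition x :: "nat \<Rightarrow> real" where "x n = Re (\<xi> n)"

lemma xi_eq: "\<xi> n = of_real (x n)"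
  using real[of n] by (simp add: x_def of_real_Re)

lemma x_mult: "x (a * b) = x a * x b"
  using mult[of a b] by (simp add: xi_eq flip: of_real_mult)

lemma x_cases: "x n = 0 \<or> x n = 1 \<or> x n = -1"
  using norm_eq_1[of n] eq_0_iff[of n] by (cases "coprime n m") (auto simp: xi_eq)

text \<open>The power series coefficients of the Lambert series of \<open>x\<close>.\<close>

definition A :: "nat \<Rightarrow> real" where "A n = (\<Sum>d | d dvd n. x d)"

text \<open>A divisor of \<open>p * n\<close> is either \<open>p\<close> times a divisor of
  \<open>n\<close>, or prime to \<open>p\<close> and then a divisor of \<open>r\<close>; so
  \<open>A (p * n) = x p * A n + A r\<close>.\<close>

lemma A_prime_power_mult:
  assumes p: "prime p" "\<not> p dvd r" "r > 0"
  shows "A (p ^ k * r) = (\<Sum>i\<le>k. x p ^ i) * A r"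
proof (induction k)
  case (Suc k)
  define n where "n = p ^ k * r"
  have p0: "p > 0" using p(1) prime_gt_0_nat by blast
  have n: "n > 0" using p p0 by (simp add: n_def)
  have dvd: "d dvd p * n \<longleftrightarrow> d dvd r" if "\<not> p dvd d" for d
  proof -
    have "coprime d (p ^ Suc k)"
      using p(1) that prime_imp_coprime coprime_commute coprime_power_right_iff by blast
    then have "d dvd p ^ Suc k * r \<longleftrightarrow> d dvd r" by (rule coprime_dvd_mult_right_iff)
    then show ?thesis by (simp add: n_def mult.assoc)
  qed
  have "{d. d dvd p * n} = (\<lambda>d. p * d) ` {d. d dvd n} \<union> {d. d dvd r}"
  proof (intro equalityI subsetI)
    fix d assume d: "d \<in> {d. d dvd p * n}"
    show "d \<in> (\<lambda>d. p * d) ` {d. d dvd n} \<union> {d. d dvd r}"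
    proof (cases "p dvd d")
      case True
      then obtain e where "d = p * e" by (elim dvdE)
      then show ?thesis using d p0 by auto
    qed (use d dvd in auto)
  next
    fix d assume "d \<in> (\<lambda>d. p * d) ` {d. d dvd n} \<union> {d. d dvd r}"
    then show "d \<in> {d. d dvd p * n}" by (auto simp: n_def)
  qed
  moreover have "(\<lambda>d. p * d) ` {d. d dvd n} \<inter> {d. d dvd r} = {}"
    using p(2) by (auto dest: dvd_mult_left)
  ultimately have "A (p * n) = (\<Sum>d\<in>(\<lambda>d. p * d) ` {d. d dvd n}. x d) + A r"
    unfolding A_def using n p(3) by (simp add: sum.union_disjoint)
  also have "(\<Sum>d\<in>(\<lambda>d. p * d) ` {d. d dvd n}. x d) = x p * A n"
    using p0 by (subst sum.reindex) (auto simp: inj_on_def A_def x_mult sum_distrib_left)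
  also have "\<dots> + A r = (\<Sum>i\<le>Suc k. x p ^ i) * A r"
    using Suc.IH by (simp only: n_def sum.atMost_Suc_shift) (simp add: algebra_simps sum_distrib_left)
  finally show ?case by (simp add: n_def mult.assoc)
qed simp

text \<open>Cancellation occurs only for \<open>x p = -1\<close>, where the parity of the top
  exponent decides between 0 and 1. This is why powers of 4, that is even powers of 2, are safe
  whatever \<open>x 2\<close> is.\<close>

lemma sum_x_power_nonneg: "(\<Sum>i\<le>k. x p ^ i) \<ge> 0"
  and sum_x_power_even_ge: "(\<Sum>i\<le>2 * k. x p ^ i) \<ge> 1"
proof -
  have alt: "(\<Sum>i\<le>k. (-1::real) ^ i) = (if even k then 1 else 0)" for k
    by (induction k) auto
  have z: "(\<Sum>i\<le>k. (0::real) ^ i) = 1" for k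
    by (induction k) auto
  show "(\<Sum>i\<le>k. x p ^ i) \<ge> 0" "(\<Sum>i\<le>2 * k. x p ^ i) \<ge> 1"
    using x_cases[of p] by (auto simp: alt z)
qed

lemma A_nonneg: "A n \<ge> 0"
proof (induction n rule: less_induct)
  case (less n)
  show ?case
  proof (cases "n \<le> 1")
    case True
    have "x 1 = 1" by (simp add: x_def)
    moreover have "n = 0 \<or> n = 1" using True by linarith
    \<comment> \<open>All naturals divide 0, and a sum over an infinite set is 0 by convention, so
      \<open>A 0 = 0\<close>.\<close>
    ultimately show ?thesis by (auto simp: A_def)
  next
    case False
    then obtain p where p: "prime p" "p dvd n" using prime_factor_nat[of n] by auto
    obtain r where r: "n = p ^ multiplicity p n * r" "\<not> p dvd r"
      using multiplicity_decompose'[of n p] False p(1) by (metis not_prime_unit One_nat_def less_eq_nat.simps(1))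
    have "r > 0" using r False by (cases "r = 0") auto
    have "multiplicity p n > 0" using p False by (simp add: prime_multiplicity_gt_zero_iff)
    then have "1 < p ^ multiplicity p n" using one_less_power[OF prime_gt_1_nat[OF p(1)]] by blast
    then have "r < n" using r(1) \<open>r > 0\<close> by (metis mult_less_cancel2 mult_1)
    then have "A r \<ge> 0" by (rule less.IH)
    then have "(\<Sum>i\<le>multiplicity p n. x p ^ i) * A r \<ge> 0" by (intro mult_nonneg_nonneg sum_x_power_nonneg)
    then show ?thesis using A_prime_power_mult[OF p(1) r(2) \<open>r > 0\<close>, of "multiplicity p n"] r(1) by simp
  qed
qed

lemma A_power_4_ge: "A (4 ^ j) \<ge> 1"
proof -
  have "A (2 ^ (2 * j) * 1) = (\<Sum>i\<le>2 * j. x 2 ^ i) * A 1"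
    by (rule A_prime_power_mult) auto
  moreover have "A 1 = 1" by (simp add: A_def x_def)
  ultimately show ?thesis using sum_x_power_even_ge[where k = j and p = 2] by (simp add: power_mult)
qed

text \<open>Finite sums replace the series: cutting off the geometric series in \<open>t ^ d\<close>
  costs at most \<open>t ^ N / (1 - t)\<close> for each \<open>d\<close>, and the total vanishes as
  \<open>N\<close> grows.\<close>

lemma sum_A_power_le:
  assumes t: "0 < t" "t < 1" and "N \<ge> 1"
  shows "(\<Sum>n=1..N. A n * t ^ n) \<le> norm (S N) / (1 - t) + 2 * real m + real N * t ^ N / (1 - t)"
proof -
  define b where "b = (\<lambda>n. 1 / (real n * (1 - t)) - t ^ n / (1 - t ^ n))"
  have "(\<Sum>n=1..N. A n * t ^ n) = (\<Sum>n=1..N. \<Sum>d | d dvd n. x d * t ^ (d * (n div d)))"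
    by (intro sum.cong refl) (simp add: A_def sum_distrib_right)
  also have "\<dots> = (\<Sum>d=1..N. \<Sum>e=1..N div d. x d * t ^ (d * e))"
    by (rule sum_divisors_swap)
  also have "\<dots> \<le> (\<Sum>d=1..N. x d * (t ^ d / (1 - t ^ d)) + t ^ N / (1 - t))"
  proof (rule sum_mono)
    fix d assume d: "d \<in> {1..N}"
    define k where "k = N div d"
    have td: "t ^ d \<le> t" using power_decreasing[of 1 d t] d t by simp
    then have td1: "t ^ d < 1" using t by simp
    have "(\<Sum>e=1..k. (t ^ d) ^ e) = (t ^ d - (t ^ d) ^ Suc k) / (1 - t ^ d)"
    proof -
      have "(\<Sum>e=1..k. q ^ e) * (1 - q) = q - q ^ Suc k" for q :: real
      proof -
        have "(\<Sum>e=1..k. q ^ e) = q * (\<Sum>i<k. q ^ i)"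
          by (simp add: sum.atLeast1_atMost_eq sum_distrib_left)
        then have "(\<Sum>e=1..k. q ^ e) * (1 - q) = q * ((1 - q) * (\<Sum>i<k. q ^ i))"
          by (simp only: mult_ac)
        then show ?thesis by (simp only: one_diff_power_eq[symmetric] right_diff_distrib power_Suc mult_1_right)
      qed
      from this[of "t ^ d"] show ?thesis using td1 by (simp add: field_simps)
    qed
    then have eq: "(\<Sum>e=1..k. x d * t ^ (d * e)) = x d * (t ^ d / (1 - t ^ d)) - x d * (t ^ (d * Suc k) / (1 - t ^ d))"
      by (simp only: power_mult diff_divide_distrib right_diff_distrib flip: sum_distrib_left)
    have "N \<le> d * Suc k" using dividend_less_times_div[of d N] d by (simp add: k_def)
    then have "t ^ (d * Suc k) \<le> t ^ N" using t by (intro power_decreasing) auto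
    then have "t ^ (d * Suc k) / (1 - t ^ d) \<le> t ^ N / (1 - t)"
      using td t by (intro frac_le) auto
    moreover have "0 \<le> t ^ (d * Suc k) / (1 - t ^ d)" using td1 t by simp
    ultimately have "- x d * (t ^ (d * Suc k) / (1 - t ^ d)) \<le> t ^ N / (1 - t)"
      using x_cases[of d] by auto
    then show "(\<Sum>e=1..N div d. x d * t ^ (d * e)) \<le> x d * (t ^ d / (1 - t ^ d)) + t ^ N / (1 - t)"
      using eq by (simp add: k_def)
  qed
  also have "\<dots> = (\<Sum>d=1..N. x d * (t ^ d / (1 - t ^ d))) + real N * t ^ N / (1 - t)"
    by (simp add: sum.distrib)
  also have "(\<Sum>d=1..N. x d * (t ^ d / (1 - t ^ d))) =
      (\<Sum>d=1..N. x d / real d * (1 / (1 - t)) - b d * x d)"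
    by (intro sum.cong) (auto simp: b_def algebra_simps)
  also have "\<dots> = (\<Sum>d=1..N. x d / real d) * (1 / (1 - t)) - (\<Sum>d=1..N. b d * x d)"
    by (simp only: sum_subtractf sum_distrib_right)
  also have "(\<Sum>d=1..N. x d / real d) = Re (S N)"
    by (simp add: S_def x_def Re_divide_of_nat)
  finally have "(\<Sum>n=1..N. A n * t ^ n) \<le>
      Re (S N) * (1 / (1 - t)) - (\<Sum>d=1..N. b d * x d) + real N * t ^ N / (1 - t)" .
  moreover have "Re (S N) * (1 / (1 - t)) \<le> norm (S N) / (1 - t)"
    using complex_Re_le_cmod[of "S N"] t by (simp add: divide_right_mono)
  \<comment> \<open>The weights decrease from \<open>b 1 = 1\<close>, so the bound for sums of
    characters over intervals carries over, uniformly in \<open>t\<close>.\<close>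
  moreover have "- (\<Sum>d=1..N. b d * x d) \<le> 2 * real m"
  proof -
    have "norm (\<Sum>d=1..<Suc N. of_real (b d) * \<xi> d) \<le> 2 * real m * b 1"
      unfolding b_def using lambert_weight_antimono[OF t]
      by (intro norm_sum_moebiuslt_antimono_le norm_sum_interval_le) auto
    also have "b 1 = 1" using t by (simp add: b_def flip: diff_divide_distrib)
    also have "(\<Sum>d=1..<Suc N. of_real (b d) * \<xi> d) = of_real (\<Sum>d=1..N. b d * x d)"
      by (simp add: xi_eq atLeastLessThanSuc_atLeastAtMost)
    finally show ?thesis unfolding norm_of_real by linarith
  qed
  ultimately show ?thesis by linarith
qed

lemma L_nonzero: "L \<noteq> 0"
proof
  assume L0: "L = 0"
  \<comment> \<open>The \<open>2 * m + 1\<close> terms with \<open>j \<le> K\<close> each tend to 1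
    as \<open>t\<close> tends to 1, which beats the bound \<open>2 * m\<close> that results from
    letting \<open>N\<close> grow at fixed \<open>t\<close>.\<close>
  define K where "K = 2 * m"
  have le: "(\<Sum>j\<le>K. t ^ (4 ^ j)) \<le> 2 * real m" if t: "0 < t" "t < 1" for t :: real
  proof (rule tendsto_lowerbound)
    have "(\<lambda>N. real N * t ^ N) \<longlonglongrightarrow> 0" using t by (intro powser_times_n_limit_0) auto
    then have "(\<lambda>N. norm (S N) / (1 - t) + 2 * real m + real N * t ^ N / (1 - t)) \<longlonglongrightarrow>
        norm L / (1 - t) + 2 * real m + 0 / (1 - t)"
      using t by (intro tendsto_intros S_tendsto) auto
    then show "(\<lambda>N. norm (S N) / (1 - t) + 2 * real m + real N * t ^ N / (1 - t)) \<longlonglongrightarrow> 2 * real m"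
      using L0 by simp
    show "\<forall>\<^sub>F N in sequentially. (\<Sum>j\<le>K. t ^ (4 ^ j)) \<le>
        norm (S N) / (1 - t) + 2 * real m + real N * t ^ N / (1 - t)"
      using eventually_ge_at_top[of "4 ^ K"]
    proof eventually_elim
      case (elim N)
      have "(\<Sum>j\<le>K. t ^ (4 ^ j)) = (\<Sum>n\<in>(\<lambda>j. 4 ^ j) ` {..K}. t ^ n)"
        by (subst sum.reindex) (auto simp: inj_on_def)
      also have "\<dots> \<le> (\<Sum>n\<in>(\<lambda>j. 4 ^ j) ` {..K}. A n * t ^ n)"
      proof (rule sum_mono)
        fix n :: nat assume "n \<in> (\<lambda>j. 4 ^ j) ` {..K}"
        then show "t ^ n \<le> A n * t ^ n"
          using A_power_4_ge t mult_right_mono[of 1 "A n" "t ^ n"] by auto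
      qed
      also have "\<dots> \<le> (\<Sum>n=1..N. A n * t ^ n)"
      proof (rule sum_mono2)
        have "4 ^ j \<le> N" if "j \<le> K" for j
          using power_increasing[of j K "4::nat"] that elim by linarith
        then show "(\<lambda>j. 4 ^ j) ` {..K} \<subseteq> {1..N}" by auto
      qed (use A_nonneg t in auto)
      also have "\<dots> \<le> norm (S N) / (1 - t) + 2 * real m + real N * t ^ N / (1 - t)"
        using elim one_le_power[of "4::nat" K] by (intro sum_A_power_le t) linarith
      finally show ?case .
    qed
  qed simp
  have "(\<Sum>j\<le>K. (1::real) ^ (4 ^ j)) \<le> 2 * real m"
  proof (rule tendsto_upperbound)
    show "((\<lambda>t::real. \<Sum>j\<le>K. t ^ (4 ^ j)) \<longlongrightarrow> (\<Sum>j\<le>K. 1 ^ (4 ^ j))) (at_left 1)"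
      by (intro tendsto_intros)
    show "\<forall>\<^sub>F t in at_left 1. (\<Sum>j\<le>K. t ^ (4 ^ j)) \<le> 2 * real m"
      using eventually_at_left_real[of 0 "1::real"] by (auto elim!: eventually_mono intro: le)
  qed auto
  then show False by (simp add: K_def)
qed

end

section \<open>Dirichlet's theorem on primes in arithmetic progressions\<close>

lemma nonprincipal_dcharacterI:
  assumes "\<xi> \<in> dcharacters m" "\<xi> \<noteq> principal_char m"
  shows "nonprincipal_dcharacter m \<xi>"
proof -
  interpret dcharacter m \<xi> using assms by (simp add: dcharacters_def)
  have "\<exists>a. coprime a m \<and> \<xi> a \<noteq> 1"
  proof (rule ccontr)
    assume "\<not> ?thesis"
    then have "\<xi> a = principal_char m a" for a
      using eq_0_iff[of a] by (auto simp: principal_char_def)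
    then show False using assms(2) by blast
  qed
  then show ?thesis by unfold_locales
qed

text \<open>Compared with the full Mertens sum, only \<open>n\<close> not coprime to
  \<open>m\<close> are missing. The primes among them divide \<open>m\<close> and are at most
  \<open>m\<close>; the nonprimes contribute at most \<open>C\<close>.\<close>

lemma principal_char_sum:
  assumes "m > 0"
  shows "\<exists>B. \<forall>N\<ge>1. norm (mangoldt_char_sum (principal_char m) N - of_real (ln (real N))) \<le> B"
proof -
  obtain C where C: "\<And>N. (\<Sum>n\<in>{n\<in>{1..N}. \<not> prime n}. mangoldt n / real n) \<le> C"
    using sum_mangoldt_nonprime_bounded by blast
  define B where "B = C + (\<Sum>n=1..m. mangoldt n / real n) + 4"
  have "norm (mangoldt_char_sum (principal_char m) N - of_real (ln (real N))) \<le> B" if N: "N \<ge> 1" for N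
  proof -
    let ?f = "\<lambda>n. mangoldt n / real n"
    let ?R = "\<Sum>n\<in>{n\<in>{1..N}. \<not> coprime n m}. ?f n"
    have nonneg: "?f n \<ge> 0" for n by (simp add: mangoldt_nonneg)
    have "mangoldt_char_sum (principal_char m) N = of_real (\<Sum>n=1..N. if coprime n m then ?f n else 0)"
      unfolding mangoldt_char_sum_def of_real_sum by (intro sum.cong) (auto simp: principal_char_def)
    also have "(\<Sum>n=1..N. if coprime n m then ?f n else 0) = (\<Sum>n=1..N. ?f n) - ?R"
    proof -
      have "?R = (\<Sum>n=1..N. if coprime n m then 0 else ?f n)"
        by (rule sum.mono_neutral_cong_left) auto
      then show ?thesis unfolding sum_subtractf[symmetric] by (simp only: sum_subtractf[symmetric]) (rule sum.cong, auto)
    qed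
    finally have eq: "mangoldt_char_sum (principal_char m) N - of_real (ln (real N)) =
        of_real ((\<Sum>n=1..N. ?f n) - ?R - ln (real N))" by simp
    have "?R \<ge> 0" by (intro sum_nonneg nonneg)
    moreover have "?R \<le> C + (\<Sum>n=1..m. ?f n)"
    proof -
      have "n \<le> m" if "prime n" "\<not> coprime n m" for n
        using that assms prime_imp_coprime dvd_imp_le by blast
      then have "?R \<le> (\<Sum>n\<in>{n\<in>{1..N}. \<not> prime n} \<union> {1..m}. ?f n)"
        by (intro sum_mono2 nonneg) auto
      also have "\<dots> \<le> (\<Sum>n\<in>{n\<in>{1..N}. \<not> prime n}. ?f n) + (\<Sum>n=1..m. ?f n)"
        using nonneg by (subst sum.union_inter[symmetric]) (auto intro!: sum_nonneg)
      finally show ?thesis using C[of N] by linarith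
    qed
    moreover have "(\<Sum>n=1..m. ?f n) \<ge> 0" by (intro sum_nonneg nonneg)
    moreover have "C \<ge> 0" using C[of 0] by simp
    ultimately have "\<bar>(\<Sum>n=1..N. ?f n) - ?R - ln (real N)\<bar> \<le> B"
      using sum_mangoldt_over_le[OF N] sum_mangoldt_over_ge[OF N] unfolding B_def by linarith
    then show ?thesis unfolding eq norm_of_real .
  qed
  then show ?thesis by blast
qed

text \<open>In the end there are no such characters. The estimate of the progression 1 modulo \<open>m\<close>, whose sum is
  nonnegative, allows at most one of them; by complex conjugation it would be real.\<close>

definition bad_chars :: "nat \<Rightarrow> (nat \<Rightarrow> complex) set" where
  "bad_chars m = {\<xi>\<in>dcharacters m. \<xi> \<noteq> principal_char m \<and> nonprincipal_dcharacter.L \<xi> = 0}"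

lemma sum_mangoldt_char_sum:
  assumes m: "m > 0" and c: "coprime c m"
  shows "\<exists>K. \<forall>N\<ge>1. norm ((\<Sum>\<xi>\<in>dcharacters m. \<xi> c * mangoldt_char_sum \<xi> N)
            - (1 - (\<Sum>\<xi>\<in>bad_chars m. \<xi> c)) * of_real (ln (real N))) \<le> K"
proof -
  \<comment> \<open>The coefficient of \<open>ln N\<close> in the sum for \<open>\<xi>\<close>: 1 by
    Mertens for the principal character, -1 when \<open>L = 0\<close>, and 0 otherwise.\<close>
  define \<delta> :: "(nat \<Rightarrow> complex) \<Rightarrow> complex" where
    "\<delta> = (\<lambda>\<xi>. if \<xi> = principal_char m then 1 else if \<xi> \<in> bad_chars m then -1 else 0)"
  have fin: "finite (dcharacters m)" using m by (rule finite_dcharacters)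
  have "\<forall>\<xi>\<in>dcharacters m. \<exists>B. \<forall>N\<ge>1. norm (mangoldt_char_sum \<xi> N - \<delta> \<xi> * of_real (ln (real N))) \<le> B"
  proof
    fix \<xi> assume \<xi>: "\<xi> \<in> dcharacters m"
    show "\<exists>B. \<forall>N\<ge>1. norm (mangoldt_char_sum \<xi> N - \<delta> \<xi> * of_real (ln (real N))) \<le> B"
    proof (cases "\<xi> = principal_char m")
      case True
      then show ?thesis using principal_char_sum[OF m] by (simp add: \<delta>_def)
    next
      case False
      interpret nonprincipal_dcharacter m \<xi> using \<xi> False by (rule nonprincipal_dcharacterI)
      show ?thesis
      proof (cases "L = 0")
        case True
        then have "\<delta> \<xi> = -1" using \<xi> False by (simp add: \<delta>_def bad_chars_def)
        then show ?thesis using mangoldt_char_sum_plus_ln_bounded[OF True] by auto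
      next
        case L: False
        then have "\<delta> \<xi> = 0" using False by (simp add: \<delta>_def bad_chars_def)
        then show ?thesis using mangoldt_char_sum_bounded[OF L] by simp
      qed
    qed
  qed
  then obtain B where B: "\<And>\<xi> N. \<xi> \<in> dcharacters m \<Longrightarrow> N \<ge> 1 \<Longrightarrow>
      norm (mangoldt_char_sum \<xi> N - \<delta> \<xi> * of_real (ln (real N))) \<le> B \<xi>"
    by (subst (asm) bchoice_iff) blast
  have "(\<Sum>\<xi>\<in>dcharacters m. \<xi> c * \<delta> \<xi>) = 1 - (\<Sum>\<xi>\<in>bad_chars m. \<xi> c)"
  proof -
    let ?p = "principal_char m"
    have p: "?p \<in> dcharacters m" "?p c = 1" "?p \<notin> bad_chars m"
      using principal_char_in[OF m] c by (auto simp: principal_char_def bad_chars_def)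
    have "(\<Sum>\<xi>\<in>dcharacters m. \<xi> c * \<delta> \<xi>) = (\<Sum>\<xi>\<in>insert ?p (bad_chars m). \<xi> c * \<delta> \<xi>)"
      using p(1) fin by (intro sum.mono_neutral_right) (auto simp: \<delta>_def bad_chars_def)
    also have "\<dots> = ?p c * \<delta> ?p + (\<Sum>\<xi>\<in>bad_chars m. \<xi> c * \<delta> \<xi>)"
      using p(3) fin by (intro sum.insert) (auto simp: bad_chars_def)
    also have "(\<Sum>\<xi>\<in>bad_chars m. \<xi> c * \<delta> \<xi>) = (\<Sum>\<xi>\<in>bad_chars m. - \<xi> c)"
      using p(3) by (intro sum.cong) (auto simp: \<delta>_def)
    finally show ?thesis using p(2) by (simp add: \<delta>_def sum_negf)
  qed
  then have eq: "(\<Sum>\<xi>\<in>dcharacters m. \<xi> c * mangoldt_char_sum \<xi> N) -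
      (1 - (\<Sum>\<xi>\<in>bad_chars m. \<xi> c)) * of_real (ln (real N)) =
      (\<Sum>\<xi>\<in>dcharacters m. \<xi> c * (mangoldt_char_sum \<xi> N - \<delta> \<xi> * of_real (ln (real N))))" for N
    by (simp add: right_diff_distrib sum_subtractf sum_distrib_right mult.assoc flip: \<open>_ = 1 - _\<close>)
  have "norm ((\<Sum>\<xi>\<in>dcharacters m. \<xi> c * mangoldt_char_sum \<xi> N)
      - (1 - (\<Sum>\<xi>\<in>bad_chars m. \<xi> c)) * of_real (ln (real N))) \<le> (\<Sum>\<xi>\<in>dcharacters m. B \<xi>)"
    if "N \<ge> 1" for N
    unfolding eq
  proof (rule sum_norm_le)
    fix \<xi> assume \<xi>: "\<xi> \<in> dcharacters m"
    then have "norm (\<xi> c) \<le> 1" by (auto simp: dcharacters_def intro: dcharacter.norm_le_1)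
    then have "norm (\<xi> c) * norm (mangoldt_char_sum \<xi> N - \<delta> \<xi> * of_real (ln (real N))) \<le> 1 * B \<xi>"
      by (intro mult_mono B \<xi> that) auto
    then show "norm (\<xi> c * (mangoldt_char_sum \<xi> N - \<delta> \<xi> * of_real (ln (real N)))) \<le> B \<xi>"
      by (simp only: norm_mult mult_1)
  qed
  then show ?thesis by blast
qed

lemma ln_nat_not_bounded:
  fixes a b K :: real
  assumes "\<And>N::nat. N \<ge> 1 \<Longrightarrow> a * ln (real N) \<le> K"
  shows "a \<le> 0"
proof (rule ccontr)
  assume "\<not> a \<le> 0"
  obtain N :: nat where N: "real N > exp (K / a)" using reals_Archimedean2 by blast
  then have "N \<ge> 1" using exp_gt_zero[of "K / a"] by (cases N) (auto simp del: exp_gt_zero)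
  then have "ln (real N) > K / a" using N using ln_less_cancel_iff[of "exp (K / a)" "real N"] by simp
  then show False using assms[OF \<open>N \<ge> 1\<close>] \<open>\<not> a \<le> 0\<close> by (simp add: field_simps)
qed

lemma sum_char_eq_sum_class:
  assumes "\<And>n. (\<Sum>\<xi>\<in>dcharacters m. \<xi> c' * \<xi> n) = (if [n = c] (mod m) then of_nat k else 0)"
  shows "(\<Sum>\<xi>\<in>dcharacters m. \<xi> c' * mangoldt_char_sum \<xi> N) =
           of_real (real k * (\<Sum>n\<in>{n\<in>{1..N}. [n = c] (mod m)}. mangoldt n / real n))"
proof -
  have "(\<Sum>\<xi>\<in>dcharacters m. \<xi> c' * mangoldt_char_sum \<xi> N) =
     (\<Sum>\<xi>\<in>dcharacters m. \<Sum>n=1..N. (\<xi> c' * \<xi> n) * of_real (mangoldt n / real n))"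
    by (simp only: mangoldt_char_sum_def sum_distrib_left mult.assoc)
  also have "\<dots> = (\<Sum>n=1..N. (\<Sum>\<xi>\<in>dcharacters m. \<xi> c' * \<xi> n) * of_real (mangoldt n / real n))"
    by (subst sum.swap) (simp only: sum_distrib_right)
  also have "\<dots> = (\<Sum>n=1..N. of_real (if [n = c] (mod m) then real k * (mangoldt n / real n) else 0))"
    by (intro sum.cong refl) (simp only: assms, simp)
  also have "\<dots> = of_real (\<Sum>n=1..N. if [n = c] (mod m) then real k * (mangoldt n / real n) else 0)"
    by (rule of_real_sum[symmetric])
  also have "(\<Sum>n=1..N. if [n = c] (mod m) then real k * (mangoldt n / real n) else 0) =
      (\<Sum>n\<in>{n\<in>{1..N}. [n = c] (mod m)}. real k * (mangoldt n / real n))"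
    by (rule sum.mono_neutral_cong_right) auto
  finally show ?thesis by (simp only: sum_distrib_left)
qed

lemma bad_chars_empty:
  assumes m: "m > 0" shows "bad_chars m = {}"
proof -
  have fin: "finite (bad_chars m)" using finite_dcharacters[OF m] by (simp add: bad_chars_def)
  have one: "\<xi> 1 = 1" if "\<xi> \<in> dcharacters m" for \<xi>
    using that by (auto simp: dcharacters_def intro: dcharacter.one)
  obtain K where K: "\<And>N. N \<ge> 1 \<Longrightarrow> norm ((\<Sum>\<xi>\<in>dcharacters m. \<xi> 1 * mangoldt_char_sum \<xi> N)
            - (1 - (\<Sum>\<xi>\<in>bad_chars m. \<xi> 1)) * of_real (ln (real N))) \<le> K"
    using sum_mangoldt_char_sum[OF m, of 1] by auto
  have bad1: "(\<Sum>\<xi>\<in>bad_chars m. \<xi> 1) = of_nat (card (bad_chars m))"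
  proof -
    have "(\<Sum>\<xi>\<in>bad_chars m. \<xi> 1) = (\<Sum>\<xi>\<in>bad_chars m. 1)"
      by (rule sum.cong) (use one in \<open>auto simp: bad_chars_def\<close>)
    then show ?thesis by simp
  qed
  \<comment> \<open>The sum over the class of 1 is nonnegative and equals
    \<open>(1 - card (bad_chars m)) * ln N\<close> up to \<open>K\<close>.\<close>
  have "(real (card (bad_chars m)) - 1) * ln (real N) \<le> K" if N: "N \<ge> 1" for N
  proof -
    let ?s = "real (card (dcharacters m)) * (\<Sum>n\<in>{n\<in>{1..N}. [n = 1] (mod m)}. mangoldt n / real n)"
    have "(\<Sum>\<xi>\<in>dcharacters m. \<xi> 1 * mangoldt_char_sum \<xi> N) = of_real ?s"
    proof (rule sum_char_eq_sum_class)
      fix n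
      have "(\<Sum>\<xi>\<in>dcharacters m. \<xi> 1 * \<xi> n) = (\<Sum>\<xi>\<in>dcharacters m. \<xi> n)"
        using one by (intro sum.cong) auto
      also have "\<dots> = (if [n = 1] (mod m) then of_nat (card (dcharacters m)) else 0)"
      proof (cases "coprime n m")
        case False
        then have "\<not> [n = 1] (mod m)" using cong_imp_coprime[OF cong_sym, of n 1 m] by auto
        moreover have "(\<Sum>\<xi>\<in>dcharacters m. \<xi> n) = 0"
          using False by (intro sum.neutral) (auto simp: dcharacters_def dcharacter.eq_0_iff)
        ultimately show ?thesis by simp
      qed (rule sum_dcharacters[OF m])
      finally show "(\<Sum>\<xi>\<in>dcharacters m. \<xi> 1 * \<xi> n) =
          (if [n = 1] (mod m) then of_nat (card (dcharacters m)) else 0)" .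
    qed
    then have "norm (of_real (?s - (1 - real (card (bad_chars m))) * ln (real N)) :: complex) \<le> K"
      using K[OF N] unfolding bad1 by simp
    moreover have "?s \<ge> 0" by (intro mult_nonneg_nonneg sum_nonneg) (auto simp: mangoldt_nonneg)
    ultimately show ?thesis unfolding norm_of_real by (simp add: left_diff_distrib)
  qed
  then have "real (card (bad_chars m)) - 1 \<le> 0" by (rule ln_nat_not_bounded)
  then have card: "card (bad_chars m) \<le> 1" by simp
  show ?thesis
  proof (rule ccontr)
    assume "bad_chars m \<noteq> {}"
    then obtain \<xi> where \<xi>: "\<xi> \<in> bad_chars m" by blast
    then have \<xi>': "\<xi> \<in> dcharacters m" "\<xi> \<noteq> principal_char m" "nonprincipal_dcharacter.L \<xi> = 0"
      by (auto simp: bad_chars_def)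
    interpret nonprincipal_dcharacter m \<xi> using \<xi>'(1,2) by (rule nonprincipal_dcharacterI)
    let ?c = "\<lambda>n. cnj (\<xi> n)"
    have c1: "?c \<in> dcharacters m" using \<xi>'(1) by (rule dcharacters_cnj)
    have c2: "?c \<noteq> principal_char m"
    proof
      assume "?c = principal_char m"
      then have "\<xi> n = principal_char m n" for n
        using fun_cong[of ?c "principal_char m" n] by (auto simp: principal_char_def split: if_splits)
      then show False using \<xi>'(2) by blast
    qed
    interpret c: nonprincipal_dcharacter m ?c using c1 c2 by (rule nonprincipal_dcharacterI)
    have "c.S = (\<lambda>N. cnj (S N))" by (simp add: fun_eq_iff c.S_def S_def)
    then have "(\<lambda>N. cnj (S N)) \<longlonglongrightarrow> c.L" using c.S_tendsto by simp
    moreover have "(\<lambda>N. cnj (S N)) \<longlonglongrightarrow> cnj L" using S_tendsto by (rule tendsto_cnj)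
    ultimately have "c.L = cnj L" by (rule LIMSEQ_unique)
    then have "?c \<in> bad_chars m" using c1 c2 \<xi>'(3) by (simp add: bad_chars_def)
    then have "?c = \<xi>" using card \<xi> fin by (metis card_le_Suc0_iff_eq One_nat_def)
    then have "\<xi> n \<in> \<real>" for n using fun_cong[of ?c \<xi> n] by (simp add: Reals_cnj_iff)
    then interpret real_dcharacter m \<xi> by unfold_locales
    show False using L_nonzero \<xi>'(3) by blast
  qed
qed

text \<open>Finitely many primes, together with at most \<open>C\<close> from the nonprimes, would
  bound the sum over the class of \<open>c\<close>, yet by orthogonality a fixed multiple of it is
  \<open>ln N + O(1)\<close>.\<close>

theorem dirichlet_primes_in_progression:
  assumes m: "m > 0" and c: "coprime c m"
  shows "infinite {p::nat. prime p \<and> [p = c] (mod m)}"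
proof
  assume fin: "finite {p::nat. prime p \<and> [p = c] (mod m)}"
  let ?P = "{p::nat. prime p \<and> [p = c] (mod m)}"
  let ?f = "\<lambda>n. mangoldt n / real n :: real"
  have nonneg: "?f n \<ge> 0" for n by (simp add: mangoldt_nonneg)
  obtain C where C: "\<And>N. (\<Sum>n\<in>{n\<in>{1..N}. \<not> prime n}. ?f n) \<le> C"
    using sum_mangoldt_nonprime_bounded by blast
  obtain c' where c': "coprime c' m"
    "\<And>n. (\<Sum>\<xi>\<in>dcharacters m. \<xi> c' * \<xi> n) = (if [n = c] (mod m) then of_nat (card (dcharacters m)) else 0)"
    using dcharacters_orthogonality[OF assms] by blast
  let ?k = "card (dcharacters m)"
  obtain K where K: "\<And>N. N \<ge> 1 \<Longrightarrow> norm ((\<Sum>\<xi>\<in>dcharacters m. \<xi> c' * mangoldt_char_sum \<xi> N)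
            - (1 - (\<Sum>\<xi>\<in>bad_chars m. \<xi> c')) * of_real (ln (real N))) \<le> K"
    using sum_mangoldt_char_sum[OF m c'(1)] by auto
  have "1 * ln (real N) \<le> K + real ?k * (C + (\<Sum>n\<in>?P. ?f n))" if N: "N \<ge> 1" for N
  proof -
    let ?s = "\<Sum>n\<in>{n\<in>{1..N}. [n = c] (mod m)}. ?f n"
    have "norm (of_real (real ?k * ?s - ln (real N)) :: complex) \<le> K"
      using K[OF N] unfolding sum_char_eq_sum_class[OF c'(2)] bad_chars_empty[OF m] by simp
    then have "ln (real N) \<le> K + real ?k * ?s" unfolding norm_of_real by linarith
    also have "?s \<le> C + (\<Sum>n\<in>?P. ?f n)"
    proof -
      have "?s \<le> (\<Sum>n\<in>{n\<in>{1..N}. \<not> prime n} \<union> ?P. ?f n)"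
        using fin by (intro sum_mono2 nonneg) auto
      also have "\<dots> \<le> (\<Sum>n\<in>{n\<in>{1..N}. \<not> prime n}. ?f n) + (\<Sum>n\<in>?P. ?f n)"
        using nonneg fin by (subst sum.union_inter[symmetric]) (auto intro!: sum_nonneg)
      finally show ?thesis using C[of N] by linarith
    qed
    finally show ?thesis by (simp add: mult_left_mono)
  qed
  from ln_nat_not_bounded[OF this] show False by simp
qed

corollary exists_large_prime_cong:
  assumes "m > 0" "coprime c m"
  shows "\<exists>p::nat. prime p \<and> p \<ge> N \<and> [p = c] (mod m)"
proof -
  have "\<not> {p::nat. prime p \<and> [p = c] (mod m)} \<subseteq> {..<N}"
    using dirichlet_primes_in_progression[OF assms] finite_subset by blast
  then show ?thesis by (auto simp: not_less)
qed

section \<open>Integer polynomials and roots of unity\<close>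

hide_const (open) UnivPoly.coeff UnivPoly.monom Module.smult Coset.order

abbreviation cpoly :: "int poly \<Rightarrow> complex poly" where
  "cpoly \<equiv> map_poly of_int"

lemma coeff_cpoly [simp]: "coeff (cpoly f) n = of_int (coeff f n)"
  by (simp add: coeff_map_poly)

lemma degree_cpoly [simp]: "degree (cpoly f) = degree f"
  by (rule degree_map_poly) simp

lemma cpoly_eq_0_iff [simp]: "cpoly f = 0 \<longleftrightarrow> f = 0"
  by (simp add: poly_eq_iff)

lemma cpoly_add: "cpoly (f + g) = cpoly f + cpoly g"
  by (simp add: poly_eq_iff)

lemma cpoly_diff: "cpoly (f - g) = cpoly f - cpoly g"
  by (simp add: poly_eq_iff)

lemma cpoly_uminus: "cpoly (- f) = - cpoly f"
  by (simp add: poly_eq_iff)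

lemma cpoly_mult: "cpoly (f * g) = cpoly f * cpoly g"
  by (simp add: poly_eq_iff coeff_mult)

lemma cpoly_smult: "cpoly (smult c f) = smult (of_int c) (cpoly f)"
  by (simp add: poly_eq_iff)

lemma cpoly_power: "cpoly (f ^ n) = cpoly f ^ n"
  by (induction n) (simp_all add: cpoly_mult)

lemma cpoly_pCons: "cpoly (pCons a f) = pCons (of_int a) (cpoly f)"
  by (simp add: map_poly_pCons)

lemma cpoly_monom: "cpoly (monom c n) = monom (of_int c) n"
  by (simp add: map_poly_monom)

lemma cpoly_pcompose: "cpoly (pcompose f g) = pcompose (cpoly f) (cpoly g)"
  by (induction f) (simp_all add: pcompose_pCons cpoly_add cpoly_mult cpoly_pCons)

lemma cpoly_pderiv: "cpoly (pderiv f) = pderiv (cpoly f)"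
  by (simp add: poly_eq_iff coeff_pderiv)

lemmas cpoly_simps = cpoly_add cpoly_uminus cpoly_diff cpoly_mult cpoly_smult cpoly_power cpoly_monom

text \<open>Pseudo-division multiplies \<open>f\<close> by a power of the leading coefficient of
  \<open>g\<close>, which is 1 here.\<close>

lemma monic_division:
  fixes f g :: "'a :: {comm_ring_1, semiring_1_no_zero_divisors} poly"
  assumes "lead_coeff g = 1"
  obtains q r where "f = g * q + r" "r = 0 \<or> degree r < degree g"
proof -
  have g: "g \<noteq> 0" using assms by auto
  obtain q r where "pseudo_divmod f g = (q, r)" by fastforce
  from pseudo_divmod[OF g this] assms show ?thesis by (intro that[of q r]) auto
qed

text \<open>Gauss's lemma. For the primitive part \<open>u\<close> of a nonzero polynomial of least
  degree, minimality gives \<open>smult a f = u * q\<close>. As \<open>f\<close> is monic and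
  \<open>u\<close> primitive, \<open>q\<close> has content \<open>\<bar>a\<bar>\<close>, so
  \<open>a\<close> divides the leading coefficient of \<open>q\<close> and that of \<open>u\<close>
  is a unit; multiplying by this unit makes \<open>u\<close> monic.\<close>

lemma obtain_minimal_int_poly:
  fixes z :: complex
  assumes f: "lead_coeff f = 1" "poly (cpoly f) z = 0"
  obtains g where "lead_coeff g = 1" "poly (cpoly g) z = 0"
    "\<And>u. poly (cpoly u) z = 0 \<Longrightarrow> u \<noteq> 0 \<Longrightarrow> degree g \<le> degree u"
proof -
  define P where "P = (\<lambda>u. u \<noteq> 0 \<and> poly (cpoly u) z = 0)"
  have "P f" using f by (auto simp: P_def)
  then obtain v where v: "P v" "\<And>u. P u \<Longrightarrow> degree v \<le> degree u"
    using ex_has_least_nat[of P f degree] by blast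
  define u where "u = primitive_part v"
  have veq: "smult (content v) u = v" by (simp add: u_def)
  have v0: "v \<noteq> 0" using v(1) by (simp add: P_def)
  have u0: "u \<noteq> 0" using v0 by (simp add: u_def)
  have "of_int (content v) * poly (cpoly u) z = 0"
    using v(1) veq unfolding P_def by (metis cpoly_smult poly_smult)
  then have uz: "poly (cpoly u) z = 0" using v0 by simp
  have umin: "degree u \<le> degree w" if "w \<noteq> 0" "poly (cpoly w) z = 0" for w
    using v(2)[of w] that by (simp add: P_def u_def)
  have cu: "content u = 1" using v0 by (simp add: u_def)
  obtain a q where aq: "a \<noteq> 0" "smult a f = u * q + pseudo_mod f u"
    using pseudo_mod(1)[OF u0, of f] by blast
  have "pseudo_mod f u = smult a f - u * q" using aq(2) by simp
  then have "poly (cpoly (pseudo_mod f u)) z = 0" using f(2) uz by (simp add: cpoly_simps)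
  then have "pseudo_mod f u = 0" using pseudo_mod(2)[OF u0, of f] umin by force
  then have eq: "smult a f = u * q" using aq(2) by simp
  have "content f dvd 1" using content_dvd_coeff[of f "degree f"] f(1) by simp
  then have "content f = 1" by (metis is_unit_normalize normalize_content)
  then have "content q = \<bar>a\<bar>" using arg_cong[OF eq, of content] cu by (simp add: content_mult)
  then have "a dvd lead_coeff q" using content_dvd_coeff[of q "degree q"] by simp
  moreover have "a = lead_coeff u * lead_coeff q"
    using arg_cong[OF eq, of lead_coeff] f(1) aq(1) by (simp add: lead_coeff_mult)
  ultimately obtain k where "a * 1 = a * (lead_coeff u * k)" by (metis dvdE mult.commute mult.left_commute mult_1_right)
  then have "lead_coeff u * k = 1" using aq(1) by (simp only: mult_cancel_left) simp
  then have lc: "lead_coeff u * lead_coeff u = 1" by (metis abs_mult abs_zmult_eq_1 abs_1 zmult_eq_1_iff mult_minus_left minus_mult_minus mult_1)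
  define g where "g = smult (lead_coeff u) u"
  show ?thesis
  proof (rule that)
    show "lead_coeff g = 1" using lc u0 by (simp add: g_def)
    show "poly (cpoly g) z = 0" using uz by (simp add: g_def cpoly_smult)
    show "degree g \<le> degree w" if "poly (cpoly w) z = 0" "w \<noteq> 0" for w
      using umin that u0 by (simp add: g_def)
  qed
qed

section \<open>The Frobenius congruence and conjugate roots of unity\<close>

lemma prime_power_add:
  fixes x y :: "'a :: comm_ring_1"
  assumes "prime p"
  shows "\<exists>s. (x + y) ^ p = x ^ p + y ^ p + of_nat p * s"
proof -
  have p0: "p > 0" using assms prime_gt_0_nat by blast
  have "(x + y) ^ p = (\<Sum>k\<le>p. of_nat (p choose k) * x ^ k * y ^ (p - k))" by (rule binomial_ring)
  also have "{..p} = insert 0 (insert p {0<..<p})" by auto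
  also have "(\<Sum>k\<in>\<dots>. of_nat (p choose k) * x ^ k * y ^ (p - k)) =
     y ^ p + (x ^ p + (\<Sum>k\<in>{0<..<p}. of_nat (p choose k) * x ^ k * y ^ (p - k)))"
    using p0 by simp
  also have "(\<Sum>k\<in>{0<..<p}. of_nat (p choose k) * x ^ k * y ^ (p - k)) =
     (\<Sum>k\<in>{0<..<p}. of_nat p * (of_nat ((p choose k) div p) * x ^ k * y ^ (p - k)))"
  proof (rule sum.cong[OF refl])
    fix k assume "k \<in> {0<..<p}"
    then have "p dvd (p choose k)" using assms by (intro dvd_choose_prime) auto
    then have "(of_nat (p choose k) :: 'a) = of_nat p * of_nat ((p choose k) div p)"
      by (metis dvd_mult_div_cancel of_nat_mult)
    then show "(of_nat (p choose k) :: 'a) * x ^ k * y ^ (p - k) =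
        of_nat p * (of_nat ((p choose k) div p) * x ^ k * y ^ (p - k))"
      by (simp only: mult.assoc)
  qed
  also have "\<dots> = of_nat p * (\<Sum>k\<in>{0<..<p}. of_nat ((p choose k) div p) * x ^ k * y ^ (p - k))"
    by (rule sum_distrib_left[symmetric])
  finally show ?thesis by (auto simp: add_ac)
qed

lemma int_power_prime_cong:
  assumes "prime p" shows "[a ^ p = a] (mod int p)"
proof -
  define n where "n = nat (a mod int p)"
  have p0: "p > 0" using assms prime_gt_0_nat by blast
  then have an: "[int n = a] (mod int p)" by (simp add: n_def)
  have "[n ^ p = n] (mod p)"
  proof (cases "p dvd n")
    case True
    then have "p dvd n ^ p" using p0 by (simp add: dvd_power_iff_le dvd_trans[OF _ dvd_power])
    then show ?thesis using True by (simp add: unique_euclidean_semiring_class.cong_def)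
  next
    case False
    have "n ^ p = n ^ (p - 1) * n" using p0 by (cases p) auto
    moreover have "[n ^ (p - 1) * n = 1 * n] (mod p)"
      using fermat_theorem[OF assms False] by (intro cong_mult) auto
    ultimately show ?thesis by simp
  qed
  then have "[int n ^ p = int n] (mod int p)" by (simp flip: cong_int_iff)
  then show ?thesis using cong_pow[OF an, of p] an by (meson cong_sym cong_trans)
qed

text \<open>Modulo \<open>p\<close> the \<open>p\<close>-th power is additive, and Fermat's
  congruence fixes the coefficients.\<close>

lemma frobenius_int_poly:
  fixes u :: "int poly"
  assumes p: "prime p"
  shows "\<exists>w. pcompose u (monom 1 p) = u ^ p + smult (int p) w"
proof (induction u)
  case 0
  show ?case using prime_gt_0_nat[OF p] by (intro exI[of _ 0]) simp
next
  case (pCons a u)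
  let ?X = "monom 1 1 :: int poly"
  obtain w where w: "pcompose u (monom 1 p) = u ^ p + smult (int p) w" using pCons.IH by blast
  obtain k where k: "a ^ p = a + int p * k"
    using int_power_prime_cong[OF p, of a] by (metis cong_iff_lin cong_sym mult.commute)
  have dec: "pCons a u = [:a:] + ?X * u" by (simp add: monom_altdef)
  obtain s where s: "([:a:] + ?X * u) ^ p = [:a:] ^ p + (?X * u) ^ p + of_nat p * s"
    using prime_power_add[OF p] by blast
  have "[:a:] ^ p = [:a:] + smult (int p) [:k:]" by (simp add: poly_const_pow k)
  moreover have "(?X * u) ^ p = monom 1 p * u ^ p" by (simp add: power_mult_distrib monom_power)
  moreover have "of_nat p * s = smult (int p) s" by (simp add: of_nat_poly)
  ultimately have pw: "pCons a u ^ p = [:a:] + smult (int p) [:k:] + monom 1 p * u ^ p + smult (int p) s"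
    using s by (simp only: dec)
  have "pcompose (pCons a u) (monom 1 p) = [:a:] + monom 1 p * (u ^ p + smult (int p) w)"
    by (simp only: pcompose_pCons w)
  also have "\<dots> = pCons a u ^ p + smult (int p) (monom 1 p * w - [:k:] - s)"
    unfolding pw by (simp only: distrib_left mult_smult_right smult_diff_right)
  finally show ?case by blast
qed

lemma power_cong_exponent:
  fixes z :: "'a :: monoid_mult"
  assumes "z ^ d = 1" "[m = n] (mod d)"
  shows "z ^ m = z ^ n"
proof -
  have "z ^ k = z ^ (k mod d)" for k
  proof -
    have "z ^ k = (z ^ d) ^ (k div d) * z ^ (k mod d)" by (simp flip: power_mult power_add)
    then show ?thesis using assms(1) by simp
  qed
  from this[of m] this[of n] assms(2) show ?thesis
    by (simp add: unique_euclidean_semiring_class.cong_def)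
qed

text \<open>This replaces the irreducibility of cyclotomic polynomials: by Dirichlet's theorem
  \<open>z ^ b = z ^ p\<close> for infinitely many primes \<open>p\<close>, and \<open>u(z ^ p)\<close> is divisible by \<open>p\<close> in the ring
  generated by \<open>z\<close>, because \<open>u(X ^ p)\<close> and \<open>u ^ p\<close> agree modulo \<open>p\<close>.\<close>

lemma poly_root_of_unity_conj:
  fixes z :: complex
  assumes d: "d > 0" "z ^ d = 1" and b: "coprime b d" and u: "poly (cpoly u) z = 0"
  shows "poly (cpoly u) (z ^ b) = 0"
proof -
  let ?h = "pcompose u (monom 1 b)"
  have comp: "poly (cpoly (pcompose u (monom 1 k))) z = poly (cpoly u) (z ^ k)" for k
    by (simp add: cpoly_pcompose cpoly_monom poly_pcompose poly_monom)
  define f :: "int poly" where "f = - 1 + monom 1 d"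
  have "degree (- 1 :: int poly) < degree (monom (1::int) d)" using d by (simp add: degree_monom_eq)
  then have "lead_coeff f = 1" unfolding f_def by (subst lead_coeff_add_le) (simp_all add: degree_monom_eq)
  moreover have "poly (cpoly f) z = 0" using d by (simp add: f_def cpoly_simps poly_monom )
  ultimately obtain g where g: "lead_coeff g = 1" "poly (cpoly g) z = 0"
    "\<And>u. poly (cpoly u) z = 0 \<Longrightarrow> u \<noteq> 0 \<Longrightarrow> degree g \<le> degree u"
    using obtain_minimal_int_poly by blast
  \<comment> \<open>By minimality of \<open>g\<close>, the value at \<open>z\<close> determines the
    remainder modulo \<open>g\<close>; so divisibility by \<open>p\<close> in the ring generated by
    \<open>z\<close> can be read off the integer coefficients of \<open>r\<close>.\<close>
  obtain q r where qr: "?h = g * q + r" "r = 0 \<or> degree r < degree g"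
    using monic_division[OF g(1)] by blast
  have hz: "poly (cpoly ?h) z = poly (cpoly r) z" using qr(1) g(2) by (simp add: cpoly_simps)
  have coeff0: "coeff r i = 0" for i
  proof (rule ccontr)
    assume ne: "coeff r i \<noteq> 0"
    \<comment> \<open>A prime larger than the coefficient that it will be shown to divide.\<close>
    obtain p where p: "prime p" "p \<ge> Suc (nat \<bar>coeff r i\<bar>)" "[p = b] (mod d)"
      using exists_large_prime_cong[OF d(1) b] by blast
    have zp: "z ^ p = z ^ b"
    using p(3) power_cong_exponent[OF d(2)] by blast
    obtain w where w: "pcompose u (monom 1 p) = u ^ p + smult (int p) w"
      using frobenius_int_poly[OF p(1)] by blast
    obtain q' r' where qr': "w = g * q' + r'" "r' = 0 \<or> degree r' < degree g"
      using monic_division[OF g(1)] by blast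
    have "poly (cpoly r) z = poly (cpoly (pcompose u (monom 1 p))) z"
      using hz comp[of b] comp[of p] zp by simp
    also have "\<dots> = of_int (int p) * poly (cpoly r') z"
      using u g(2) prime_gt_0_nat[OF p(1)] by (simp add: w qr'(1) cpoly_simps)
    finally have "poly (cpoly (r - smult (int p) r')) z = 0" by (simp add: cpoly_simps)
    moreover have "r - smult (int p) r' = 0 \<or> degree (r - smult (int p) r') < degree g"
      using qr(2) qr'(2) ne prime_gt_0_nat[OF p(1)] degree_diff_less[of r "degree g" "smult (int p) r'"] by (cases "r' = 0") auto
    ultimately have "r - smult (int p) r' = 0" using g(3) by force
    then have "coeff r i = int p * coeff r' i" by (metis coeff_smult eq_iff_diff_eq_0)
    then have "int p \<le> \<bar>coeff r i\<bar>" using dvd_imp_le_int[OF ne, of "int p"] by simp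
    then show False using p(2) by linarith
  qed
  have "r = 0" by (rule poly_eqI) (simp add: coeff0)
  then show ?thesis using hz comp[of b] by simp
qed

text \<open>An inverse \<open>b'\<close> of \<open>b\<close> modulo \<open>d\<close> makes vanishing
  at \<open>z\<close> and at \<open>z ^ b\<close> equivalent. Multiplicities follow by induction,
  since the derivative is again an integer polynomial and lowers the order at a root by one.\<close>

lemma order_root_of_unity_conj:
  fixes z :: complex
  assumes d: "d > 0" "z ^ d = 1" and b: "coprime b d" and "u \<noteq> 0"
  shows "order (z ^ b) (cpoly u) = order z (cpoly u)"
  using \<open>u \<noteq> 0\<close>
proof (induction "degree u" arbitrary: u rule: less_induct)
  case less
  obtain b' where b': "[b * b' = 1] (mod d)" using cong_solve_coprime_nat[OF b] by auto
  have "coprime (b * b') d" using cong_imp_coprime[OF cong_sym[OF b']] by simp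
  then have cb': "coprime b' d" by simp
  have "z ^ (b * b') = z"
    using power_cong_exponent[OF d(2), of "b * b'" 1] b' by simp
  then have inv: "(z ^ b) ^ b' = z" by (simp add: power_mult)
  have "(z ^ b) ^ d = 1" using d(2) by (metis mult.commute power_mult power_one)
  then have iff: "poly (cpoly u) (z ^ b) = 0 \<longleftrightarrow> poly (cpoly u) z = 0"
    using poly_root_of_unity_conj[OF d b] poly_root_of_unity_conj[OF d(1) _ cb', of "z ^ b"] inv by metis
  show ?case
  proof (cases "poly (cpoly u) z = 0")
    case True
    have deg: "degree u \<noteq> 0"
    proof (intro notI)
      assume "degree u = 0"
      then obtain c where "u = [:c:]" by (elim degree_eq_zeroE)
      then show False using True less.prems by (simp add: cpoly_pCons)
    qed
    then have pd: "pderiv u \<noteq> 0" by (simp add: pderiv_eq_0_iff)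
    have "order (z ^ b) (cpoly (pderiv u)) = order z (cpoly (pderiv u))"
      using deg by (intro less.hyps pd) (simp add: degree_pderiv)
    moreover have "order y (cpoly u) = Suc (order y (cpoly (pderiv u)))" if "poly (cpoly u) y = 0" for y
      using that pd less.prems by (subst order_pderiv) (auto simp: order_root simp flip: cpoly_pderiv)
    ultimately show ?thesis using True iff by simp
  next
    case False
    then show ?thesis using iff by (simp add: order_0I)
  qed
qed

section \<open>Divisibility forces roots of unity\<close>

lemma poly_int_cong:
  fixes f :: "int poly"
  assumes "[a = b] (mod m)" shows "[poly f a = poly f b] (mod m)"
  using assms by (induction f) (auto intro!: cong_add cong_mult)

text \<open>Lagrange's bound for roots in a field, stated with pairwise incongruent integers:
  dividing by \<open>X - a\<close> leaves the constant \<open>poly f a\<close>, a multiple of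
  \<open>q\<close>, so the other roots pass to the quotient.\<close>

lemma card_roots_mod_prime_le:
  fixes f :: "int poly"
  assumes "prime q" "lead_coeff f = 1" "finite A"
    and "\<And>a. a \<in> A \<Longrightarrow> q dvd poly f a"
    and "\<And>a b. a \<in> A \<Longrightarrow> b \<in> A \<Longrightarrow> [a = b] (mod q) \<Longrightarrow> a = b"
  shows "card A \<le> degree f"
  using assms(2-5)
proof (induction "degree f" arbitrary: f A rule: less_induct)
  case less
  show ?case
  proof (cases "A = {}")
    case False
    then obtain a where a: "a \<in> A" by blast
    have "degree f \<noteq> 0"
    proof
      assume "degree f = 0"
      then have "f = 1" using less.prems(1) by (elim degree_eq_zeroE) (simp add: one_pCons)
      then show False using less.prems(3)[OF a] assms(1) by auto
    qed
    define g where "g = synthetic_div f a"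
    have f: "f = [:- a, 1:] * g + [:poly f a:]" by (simp only: g_def synthetic_div_correct')
    have dg: "degree g < degree f" using \<open>degree f \<noteq> 0\<close> by (simp add: g_def degree_synthetic_div)
    have "g \<noteq> 0" using \<open>degree f \<noteq> 0\<close> f by (intro notI) (metis add_0 degree_pCons_0 mult_zero_right)
    then have "degree ([:- a, 1:] * g) > degree [:poly f a:]" by (simp add: degree_mult_eq del: mult_pCons_left)
    then have "lead_coeff ([:poly f a:] + [:- a, 1:] * g) = lead_coeff ([:- a, 1:] * g)"
      by (rule lead_coeff_add_le)
    also have "[:poly f a:] + [:- a, 1:] * g = f" using f by (simp only: add.commute)
    finally have "lead_coeff f = lead_coeff ([:- a, 1:] * g)" .
    then have lg: "lead_coeff g = 1" using less.prems(1) by (simp add: lead_coeff_mult del: mult_pCons_left)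
    have "card (A - {a}) \<le> degree g"
    proof (rule less.hyps[OF dg lg])
      fix b assume b: "b \<in> A - {a}"
      have "poly f b = (b - a) * poly g b + poly f a"
        using arg_cong[OF f, of "\<lambda>f. poly f b"] by (simp add: algebra_simps)
      then have "q dvd (b - a) * poly g b"
        using less.prems(3)[OF a] less.prems(3)[of b] b by (metis Diff_iff dvd_add_left_iff)
      moreover have "\<not> q dvd b - a"
        using less.prems(4)[of b a] a b by (auto simp: cong_iff_dvd_diff)
      ultimately show "q dvd poly g b" using assms(1) prime_dvd_mult_iff by blast
    qed (use less.prems in auto)
    then show ?thesis using dg a less.prems(2) by (simp add: card_Diff_singleton)
  qed simp
qed

text \<open>If \<open>r ^ e\<close> exactly divides \<open>k\<close> and \<open>e > 0\<close>, then
  \<open>r ^ (e - 1) * (r - 1) \<le> D\<close>; hence \<open>r \<le> D + 1\<close> and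
  \<open>r ^ (e - 1) \<le> D\<close>, so \<open>r ^ e \<le> D * (D + 1)\<close> divides the
  factorial.\<close>

lemma dvd_fact_of_totient_le:
  assumes "k > 0" "totient k \<le> D"
  shows "k dvd fact (D * (D + 1))"
proof (rule multiplicity_le_imp_dvd)
  fix r :: nat assume r: "prime r"
  define e where "e = multiplicity r k"
  show "multiplicity r k \<le> multiplicity r (fact (D * (D + 1)))"
  proof (cases "e = 0")
    case False
    then have e: "e > 0" by simp
    have "r ^ e dvd k" by (simp add: e_def multiplicity_dvd)
    then have "totient (r ^ e) \<le> D"
      using assms totient_dvd[of "r ^ e" k] by (meson dvd_imp_le le_trans totient_gt_0_iff)
    then have le: "r ^ (e - 1) * (r - 1) \<le> D" using r e by (simp add: totient_prime_power)
    have r2: "r \<ge> 2" using r by (rule prime_ge_2_nat)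
    have "r - 1 \<le> r ^ (e - 1) * (r - 1)" "r ^ (e - 1) \<le> r ^ (e - 1) * (r - 1)" using r2 by auto
    then have "r \<le> D + 1" "r ^ (e - 1) \<le> D" using le by linarith+
    moreover have "r ^ e = r ^ (e - 1) * r" using e by (cases e) auto
    ultimately have "r ^ e \<le> D * (D + 1)" by (metis mult_le_mono)
    then have "r ^ e dvd fact (D * (D + 1))" using r2 by (intro dvd_fact) auto
    then show ?thesis unfolding e_def[symmetric]
      using r by (subst power_dvd_iff_le_multiplicity[symmetric]) auto
  qed (simp add: e_def)
qed (use assms in auto)

text \<open>The values \<open>n ^ b\<close> with \<open>b\<close> coprime to the order \<open>k\<close> of \<open>n\<close> modulo \<open>q\<close> are roots of \<open>f\<close>
  modulo \<open>q\<close>: apply the hypothesis to a prime \<open>p\<close> with \<open>p = n\<close> modulo \<open>q\<close> and \<open>p = b\<close> modulo \<open>k\<close>.\<close>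

lemma totient_ord_le_degree:
  fixes f :: "int poly"
  assumes monic: "lead_coeff f = 1"
    and hyp: "\<And>p. prime p \<Longrightarrow> p \<ge> N \<Longrightarrow> poly f (int p) dvd poly f (int p ^ p)"
    and q: "prime q" "\<not> q dvd n" "int q dvd poly f (int n)"
  shows "totient (ord q n) \<le> degree f"
proof -
  define k where "k = ord q n"
  have cop: "coprime q n" using q(1,2) prime_imp_coprime by blast
  then have k0: "k > 0" by (simp add: k_def)
  \<comment> \<open>Coprimality of \<open>q\<close> and \<open>k\<close> lets the Chinese remainder
    theorem impose the conditions on base and exponent simultaneously.\<close>
  have "k dvd q - 1" using order_divides_totient[OF cop] q(1) by (simp add: k_def totient_prime)
  then have "k < q" using prime_gt_1_nat[OF q(1)] by (auto dest!: dvd_imp_le)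
  then have qk: "coprime q k" using q(1) k0 by (intro prime_imp_coprime) (auto dest: dvd_imp_le)
  have root: "int q dvd poly f (int (n ^ b))" if b: "coprime b k" for b
  proof -
    obtain c where c: "[c = n] (mod q)" "[c = b] (mod k)"
      using binary_chinese_remainder_nat[OF qk] by blast
    have "coprime c q" using cop c(1) cong_imp_coprime[OF cong_sym[OF c(1)]] by (simp add: coprime_commute)
    moreover have "coprime c k" using b cong_imp_coprime[OF cong_sym[OF c(2)]] by simp
    ultimately have "coprime c (q * k)" by simp
    moreover have "q * k > 0" using k0 prime_gt_0_nat[OF q(1)] by simp
    ultimately obtain p where p: "prime p" "p \<ge> N" "[p = c] (mod (q * k))"
      using exists_large_prime_cong by blast
    have pq: "[p = n] (mod q)" using cong_modulus_mult_nat[OF p(3)] c(1) cong_trans by blast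
    have "[p = c] (mod (k * q))" using p(3) by (simp only: mult.commute)
    then have pk: "[p = b] (mod k)" using cong_modulus_mult_nat c(2) cong_trans by blast
    have "[p ^ p = n ^ p] (mod q)" by (rule cong_pow[OF pq])
    also have "[n ^ p = n ^ b] (mod q)"
      using pk by (subst order_divides_expdiff[OF cop]) (simp add: k_def)
    finally have "[int p ^ p = int (n ^ b)] (mod int q)" by (simp flip: cong_int_iff)
    then have 1: "[poly f (int p ^ p) = poly f (int (n ^ b))] (mod int q)" by (rule poly_int_cong)
    have "[int p = int n] (mod int q)" using pq by (simp add: cong_int_iff)
    then have "[poly f (int p) = poly f (int n)] (mod int q)" by (rule poly_int_cong)
    then have "int q dvd poly f (int p)" using q(3) cong_dvd_iff by blast
    then have "int q dvd poly f (int p ^ p)" using hyp[OF p(1,2)] dvd_trans by blast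
    then show ?thesis using 1 cong_dvd_iff by blast
  qed
  define A where "A = (\<lambda>b. int (n ^ b)) ` totatives k"
  have inj: "b = b'" if "b \<in> totatives k" "b' \<in> totatives k" "[int (n ^ b) = int (n ^ b')] (mod int q)" for b b'
  proof -
    have "[n ^ b = n ^ b'] (mod q)" using that(3) by (simp only: cong_int_iff)
    then have "[b = b'] (mod k)" using order_divides_expdiff[OF cop] by (simp add: k_def)
    then have "int k dvd int b - int b'" by (simp add: cong_iff_dvd_diff flip: cong_int_iff)
    moreover have "\<bar>int b - int b'\<bar> < int k" using that(1,2) by (auto simp: in_totatives_iff)
    ultimately show ?thesis using dvd_imp_le_int[of "int b - int b'" "int k"] by (cases "b = b'") auto
  qed
  have "card A \<le> degree f"
  proof (rule card_roots_mod_prime_le[of "int q"])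
    show "int q dvd poly f a" if "a \<in> A" for a
      using that root by (auto simp: A_def in_totatives_iff)
    show "a = b" if "a \<in> A" "b \<in> A" "[a = b] (mod int q)" for a b
      using that inj unfolding A_def by blast
  qed (use q(1) monic in \<open>auto simp: A_def\<close>)
  moreover have "inj_on (\<lambda>b. int (n ^ b)) (totatives k)"
    by (intro inj_onI inj) auto
  ultimately show ?thesis by (simp add: A_def card_image totient_def k_def)
qed

text \<open>A nonzero \<open>w\<close> of least degree in the ideal of \<open>g\<close> and
  \<open>T\<close> divides both up to integer factors. It cannot vanish at \<open>z\<close> because
  \<open>T\<close> does not, so the cofactor of \<open>g\<close> does; by minimality that cofactor
  has the full degree of \<open>g\<close>, and \<open>w\<close> is constant.\<close>

lemma minimal_poly_bezout:
  fixes z :: complex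
  assumes g: "g \<noteq> 0" "poly (cpoly g) z = 0"
    "\<And>u. poly (cpoly u) z = 0 \<Longrightarrow> u \<noteq> 0 \<Longrightarrow> degree g \<le> degree u"
    and T: "poly (cpoly T) z \<noteq> 0"
  obtains u v R where "R \<noteq> 0" "u * g + v * T = [:R:]"
proof -
  define I where "I = (\<lambda>w. \<exists>u v. w = u * g + v * T)"
  have Ig: "I g" unfolding I_def by (intro exI[of _ 1] exI[of _ 0]) simp
  have IT: "I T" unfolding I_def by (intro exI[of _ 0] exI[of _ 1]) simp
  have I_comb: "I (smult a x - w * s)" if I: "I x" "I w" for a x w s
  proof -
    obtain u v u' v' where "x = u * g + v * T" "w = u' * g + v' * T" using I unfolding I_def by blast
    then have "smult a x - w * s = (smult a u - u' * s) * g + (smult a v - v' * s) * T"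
      by (simp add: algebra_simps smult_add_right)
    then show ?thesis unfolding I_def by blast
  qed
  have "\<exists>w. (w \<noteq> 0 \<and> I w) \<and> (\<forall>y. y \<noteq> 0 \<and> I y \<longrightarrow> degree w \<le> degree y)"
    by (rule ex_has_least_nat[where k = g]) (use g(1) Ig in simp)
  then obtain w where w: "w \<noteq> 0" "I w" "\<And>y. y \<noteq> 0 \<Longrightarrow> I y \<Longrightarrow> degree w \<le> degree y" by blast
  have div: "\<exists>a s. a \<noteq> 0 \<and> smult a x = w * s" if "I x" for x
  proof -
    obtain a s where as: "a \<noteq> 0" "smult a x = w * s + pseudo_mod x w"
      using pseudo_mod(1)[OF w(1), of x] by blast
    then have "pseudo_mod x w = smult a x - w * s" by simp
    then have "I (pseudo_mod x w)" using I_comb[OF that w(2)] by simp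
    then have "pseudo_mod x w = 0" using pseudo_mod(2)[OF w(1), of x] w(3) by force
    then show ?thesis using as by auto
  qed
  obtain a s where as: "a \<noteq> 0" "smult a g = w * s" using div[OF Ig] by blast
  obtain b t where bt: "b \<noteq> 0" "smult b T = w * t" using div[OF IT] by blast
  have "of_int b * poly (cpoly T) z = poly (cpoly w) z * poly (cpoly t) z"
    using arg_cong[OF bt(2), of "\<lambda>f. poly (cpoly f) z"] by (simp add: cpoly_simps)
  then have wz: "poly (cpoly w) z \<noteq> 0" using bt(1) T by auto
  have "of_int a * poly (cpoly g) z = poly (cpoly w) z * poly (cpoly s) z"
    using arg_cong[OF as(2), of "\<lambda>f. poly (cpoly f) z"] by (simp add: cpoly_simps)
  then have "poly (cpoly s) z = 0" using g(2) wz by simp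
  moreover have s0: "s \<noteq> 0" using as g(1) by (intro notI) simp
  ultimately have "degree g \<le> degree s" by (rule g(3))
  moreover have "degree g = degree w + degree s"
    using arg_cong[OF as(2), of degree] as(1) w(1) s0 by (simp add: degree_mult_eq)
  ultimately have "degree w = 0" by simp
  then obtain R where "w = [:R:]" by (elim degree_eq_zeroE)
  then show ?thesis using w(1,2) that unfolding I_def by auto
qed

text \<open>Schur's argument: for \<open>n = |g 0| |R| k\<close> the cofactor of \<open>g n\<close> at \<open>g 0\<close> is 1 modulo \<open>R\<close>.\<close>

lemma exists_prime_dvd_poly_not_dvd:
  fixes g :: "int poly"
  assumes "degree g > 0" "poly g 0 \<noteq> 0" "R \<noteq> 0"
  obtains q n :: nat where "prime q" "int q dvd poly g (int n)" "\<not> int q dvd R"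
proof -
  define c where "c = poly g 0"
  have c: "c \<noteq> 0" using assms by (simp add: c_def)
  \<comment> \<open>A nonzero value of \<open>h\<close> excludes \<open>poly g n = 0\<close>,
    \<open>c\<close> and \<open>-c\<close>, that is \<open>w = 0\<close>, 1 and -1, so that
    \<open>w\<close> has a prime divisor.\<close>
  define h where "h = g * (g - [:c:]) * (g + [:c:])"
  have "g \<noteq> [:e:]" for e using assms(1) by auto
  from this[of 0] this[of c] this[of "- c"] have "g \<noteq> 0" "g - [:c:] \<noteq> 0" "g + [:c:] \<noteq> 0"
    by (simp_all add: add_eq_0_iff2)
  then have h0: "h \<noteq> 0" by (simp add: h_def)
  define x where "x = (\<lambda>k::nat. nat (\<bar>c\<bar> * \<bar>R\<bar>) * k)"
  have "inj (\<lambda>k. int (x k))" using c assms(3) by (auto simp: inj_on_def x_def)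
  then have "infinite (range (\<lambda>k. int (x k)))" by (rule range_inj_infinite)
  then have "\<not> range (\<lambda>k. int (x k)) \<subseteq> {y. poly h y = 0}"
    using poly_roots_finite[OF h0] finite_subset by blast
  then obtain k where k: "poly h (int (x k)) \<noteq> 0" by blast
  define n where "n = x k"
  \<comment> \<open>The sign factor rewrites the nonnegative \<open>n\<close> as a multiple of
    \<open>c * R\<close> itself; one factor \<open>c\<close> then splits off from
    \<open>poly g n = c + n * y\<close>.\<close>
  have n: "int n = c * R * (sgn (c * R) * int k)"
    by (simp add: n_def x_def abs_mult_sgn flip: abs_mult)
       (metis mult.assoc mult.commute abs_mult abs_sgn)
  obtain y where y: "poly g (int n) = c + int n * y" by (cases g) (auto simp: c_def)
  define w where "w = 1 + R * (sgn (c * R) * int k * y)"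
  have gw: "poly g (int n) = c * w" using y n by (simp add: w_def algebra_simps)
  have "w \<noteq> 0" "w \<noteq> 1" "w \<noteq> -1" using k gw by (auto simp: h_def n_def)
  then have "\<not> is_unit w" by auto
  then obtain q where q: "prime q" "q dvd w" using \<open>w \<noteq> 0\<close> prime_divisor_exists by blast
  have "\<not> q dvd R"
  proof
    assume "q dvd R"
    then have "q dvd 1" using q(2) unfolding w_def by (metis dvd_add_left_iff dvd_mult2)
    then show False using q(1) not_prime_unit by blast
  qed
  moreover have "q dvd poly g (int n)" using q(2) gw by simp
  moreover have "int (nat q) = q" using q(1) prime_ge_0_int by simp
  moreover have "prime (nat q)" using q(1) prime_int_nat_transfer by blast
  ultimately show ?thesis using that[of "nat q" n] by metis
qed

lemma roots_are_roots_of_unity: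
  fixes f :: "int poly" and z :: complex
  assumes monic: "lead_coeff f = 1"
    and hyp: "\<And>p. prime p \<Longrightarrow> p \<ge> N \<Longrightarrow> poly f (int p) dvd poly f (int p ^ p)"
    and z: "poly (cpoly f) z = 0" "z \<noteq> 0"
  shows "z ^ fact (degree f * (degree f + 1)) = 1"
proof (rule ccontr)
  define L :: nat where "L = fact (degree f * (degree f + 1))"
  assume "z ^ fact (degree f * (degree f + 1)) \<noteq> 1"
  then have zL: "z ^ L \<noteq> 1" by (simp add: L_def)
  obtain g where g: "lead_coeff g = 1" "poly (cpoly g) z = 0"
    "\<And>u. poly (cpoly u) z = 0 \<Longrightarrow> u \<noteq> 0 \<Longrightarrow> degree g \<le> degree u"
    using obtain_minimal_int_poly[OF monic z(1)] by blast
  have g0: "g \<noteq> 0" using g(1) by auto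
  \<comment> \<open>The nonzero roots of \<open>T\<close> are the \<open>L\<close>-th roots of
    unity, so \<open>z\<close> is not among its roots; and \<open>q\<close> divides
    \<open>T n\<close> as soon as it divides \<open>n\<close> or the order of \<open>n\<close>
    divides \<open>L\<close>.\<close>
  define T :: "int poly" where "T = monom 1 1 * (monom 1 L - 1)"
  have "poly (cpoly T) z = z * (z ^ L - 1)" by (simp add: T_def cpoly_simps poly_monom)
  then have Tz: "poly (cpoly T) z \<noteq> 0" using z(2) zL by simp
  obtain u v R where R: "R \<noteq> 0" "u * g + v * T = [:R:]"
    by (rule minimal_poly_bezout[OF g0 g(2) g(3) Tz])
  have dg: "degree g > 0"
  proof (rule ccontr)
    assume "\<not> degree g > 0"
    then have "g = 1" using g(1) by (auto elim!: degree_eq_zeroE simp: one_pCons)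
    then show False using g(2) by simp
  qed
  have g00: "poly g 0 \<noteq> 0"
  proof
    assume "poly g 0 = 0"
    then obtain h where h: "g = pCons 0 h" by (cases g) simp
    then have "poly (cpoly h) z = 0" using g(2) z(2) by (simp add: cpoly_pCons)
    moreover have "h \<noteq> 0" using h g0 by auto
    ultimately have "degree g \<le> degree h" by (rule g(3))
    then show False using h \<open>h \<noteq> 0\<close> by simp
  qed
  obtain q n :: nat where q: "prime q" "int q dvd poly g (int n)" "\<not> int q dvd R"
    by (rule exists_prime_dvd_poly_not_dvd[OF dg g00 R(1)])
  obtain s r where sr: "f = g * s + r" "r = 0 \<or> degree r < degree g"
    using monic_division[OF g(1)] by blast
  have "poly (cpoly r) z = 0" using sr(1) z(1) g(2) by (simp add: cpoly_simps)
  then have "r = 0" using sr(2) g(3)[of r] by force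
  then have "int q dvd poly f (int n)" using sr(1) q(2) by simp
  have "poly T (int n) = int n * (int n ^ L - 1)" by (simp add: T_def poly_monom)
  moreover have "R = poly u (int n) * poly g (int n) + poly v (int n) * poly T (int n)"
    using arg_cong[OF R(2), of "\<lambda>f. poly f (int n)"] by simp
  ultimately have ndvd: "\<not> int q dvd int n * (int n ^ L - 1)" using q(2,3) by auto
  then have "\<not> q dvd n" by auto
  have "totient (ord q n) \<le> degree f"
    by (rule totient_ord_le_degree[where N = N, OF monic hyp q(1) \<open>\<not> q dvd n\<close> \<open>int q dvd poly f (int n)\<close>])
  moreover have "ord q n > 0" using q(1) \<open>\<not> q dvd n\<close> prime_imp_coprime by simp
  ultimately have "ord q n dvd L" unfolding L_def by (intro dvd_fact_of_totient_le)
  then have "[n ^ L = 1] (mod q)" by (simp only: ord_divides)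
  then have "[int n ^ L = 1] (mod int q)" by (simp flip: cong_int_iff)
  then show False using ndvd by (simp add: cong_iff_dvd_diff)
qed

section \<open>Cyclotomic products\<close>

lemma cis_frac_power:
  "cis (2 * pi * real k / real i) ^ n = cis (2 * pi * real (k * n) / real i)"
  unfolding Complex.DeMoivre by (intro arg_cong[of _ _ cis]) simp

lemma cis_frac_mod:
  assumes "i > 0"
  shows "cis (2 * pi * real k / real i) = cis (2 * pi * real (k mod i) / real i)"
proof -
  have "real k = real i * real (k div i) + real (k mod i)"
    by (metis mult_div_mod_eq of_nat_add of_nat_mult)
  then have "2 * pi * real k / real i = 2 * pi * real (k div i) + 2 * pi * real (k mod i) / real i"
    using assms by (simp add: field_simps)
  then show ?thesis by (simp add: cis_mult[symmetric])
qed

text \<open>Both fractions lie in the half-open interval from 0 (excluded) to 1 (included), so an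
  integer difference is 0. The end 1 is included because 1 is the totative of 1.\<close>

lemma cis_frac_inject:
  assumes "0 < k" "k \<le> i" "0 < k'" "k' \<le> i'"
    and "cis (2 * pi * real k / real i) = cis (2 * pi * real k' / real i')"
  shows "k * i' = k' * i"
proof -
  have pos: "i > 0" "i' > 0" using assms by auto
  define a where "a = real k / real i"
  define b where "b = real k' / real i'"
  have ab: "0 < a" "a \<le> 1" "0 < b" "b \<le> 1" using assms pos by (auto simp: a_def b_def)
  have "cis (2 * pi * a) = cis (2 * pi * b)" using assms(5) by (simp add: a_def b_def)
  then obtain n :: int where n: "2 * pi * b = 2 * pi * a + 2 * pi * n"
    using sin_cos_eq_iff[of "2 * pi * b" "2 * pi * a"] by (auto simp: complex_eq_iff)
  then have "2 * pi * b = 2 * pi * (a + n)" by (simp only: distrib_left)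
  then have "b = a + n" using pi_gt_zero by (simp only: mult_cancel_left) simp
  then have "\<bar>real_of_int n\<bar> < 1" using ab by linarith
  then have "n = 0" by linarith
  then have "real (k * i') = real (k' * i)" using \<open>b = a + n\<close> pos by (simp add: a_def b_def field_simps)
  then show ?thesis by (simp only: of_nat_eq_iff)
qed

text \<open>Injectivity is uniqueness of reduced fractions; surjectivity is a count, since the
  totients of the divisors of \<open>L\<close> sum to \<open>L\<close>.\<close>

lemma bij_betw_roots_of_unity_totatives:
  assumes "L > 0"
  shows "bij_betw (\<lambda>(i, k). cis (2 * pi * real k / real i))
           (SIGMA i:{i. i dvd L}. totatives i) {z::complex. z ^ L = 1}"
proof -
  let ?f = "\<lambda>(i, k). cis (2 * pi * real k / real i)"
  let ?S = "SIGMA i:{i. i dvd L}. totatives i"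
  have inj: "inj_on ?f ?S"
  proof (rule inj_onI, clarify)
    fix i k i' k' assume *: "i dvd L" "k \<in> totatives i" "i' dvd L" "k' \<in> totatives i'"
      "cis (2 * pi * real k / real i) = cis (2 * pi * real k' / real i')"
    then have "k * i' = k' * i" by (intro cis_frac_inject) (auto simp: in_totatives_iff)
    then show "i = i' \<and> k = k'"
      using *(2,4) coprime_crossproduct_nat[of k i k' i'] by (auto simp: in_totatives_iff mult.commute)
  qed
  have fin: "finite {z::complex. z ^ L = 1}" using assms finite_nth_roots[of L 1] by simp
  have "?f ` ?S \<subseteq> {z. z ^ L = 1}"
  proof clarify
    fix i k assume *: "i dvd L" "k \<in> totatives i"
    then obtain j where j: "L = i * j" by (elim dvdE)
    have "i > 0" using * by (auto simp: in_totatives_iff)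
    then have "2 * pi * real (k * L) / real i = 2 * pi * real (k * j)" by (simp add: j)
    then have "cis (2 * pi * real (k * L) / real i) = 1" by (simp only: cis_multiple_2pi Ints_of_nat)
    then show "cis (2 * pi * real k / real i) ^ L = 1" by (simp only: cis_frac_power)
  qed
  moreover have "card (?f ` ?S) = card {z::complex. z ^ L = 1}"
  proof -
    have "card (?f ` ?S) = card ?S" by (rule card_image[OF inj])
    also have "\<dots> = (\<Sum>i | i dvd L. totient i)"
      using assms by (simp add: card_SigmaI totient_def)
    also have "\<dots> = card {z::complex. z ^ L = 1}"
      using assms by (simp add: totient_divisor_sum card_roots_unity_eq)
    finally show ?thesis .
  qed
  ultimately have "?f ` ?S = {z. z ^ L = 1}" using fin by (intro card_subset_eq) auto
  then show ?thesis using inj by (simp add: bij_betw_def)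
qed

lemma inj_on_cis_totatives: "inj_on (\<lambda>k. cis (2 * pi * real k / real d)) (totatives d)"
proof (rule inj_onI)
  fix k k' assume *: "k \<in> totatives d" "k' \<in> totatives d"
    "cis (2 * pi * real k / real d) = cis (2 * pi * real k' / real d)"
  have "k * d = k' * d" by (rule cis_frac_inject[OF _ _ _ _ *(3)]) (use * in \<open>auto simp: in_totatives_iff\<close>)
  then show "k = k'" using *(1) by (auto simp: in_totatives_iff)
qed

section \<open>Divisibility of cyclotomic polynomials\<close>

lemma poly_cyclotomic_poly_eq_0:
  assumes "d > 0" "coprime k d"
  shows "poly (cyclotomic_poly d) (cis (2 * pi * real k / real d)) = 0"
proof -
  \<comment> \<open>Reduction modulo \<open>d\<close> reaches the totatives except for
    \<open>d = 1\<close>, where it would give 0 instead of 1.\<close>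
  define k' where "k' = (if d = 1 then 1 else k mod d)"
  have k': "k' \<in> totatives d"
  proof (cases "d = 1")
    case False
    have "\<not> d dvd k"
    proof
      assume "d dvd k"
      from coprime_common_divisor[OF assms(2) this dvd_refl] have "is_unit d" .
      then show False using False by simp
    qed
    then have "k mod d \<noteq> 0" by (simp add: dvd_eq_mod_eq_0)
    then show ?thesis using False assms by (auto simp: k'_def in_totatives_iff coprime_commute)
  qed (simp add: k'_def)
  have "cis (2 * pi * real k / real d) = cis (2 * pi * real k' / real d)"
    using cis_frac_mod[OF assms(1), of k] by (auto simp: k'_def)
  then show ?thesis
    unfolding cyclotomic_poly_def poly_prod using k' by (intro prod_zero bexI[of _ k']) auto
qed

lemma prod_linear_factors_dvd:
  fixes P :: "'a :: idom poly"
  assumes "finite K" "inj_on h K" "\<And>k. k \<in> K \<Longrightarrow> poly P (h k) = 0"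
  shows "(\<Prod>k\<in>K. [:- h k, 1:]) dvd P"
  using assms
proof (induction K arbitrary: P rule: finite_induct)
  case (insert k K)
  obtain Q where Q: "P = [:- h k, 1:] * Q" using insert.prems(2)[of k] by (auto simp: poly_eq_0_iff_dvd elim: dvdE)
  have "poly Q (h j) = 0" if "j \<in> K" for j
  proof -
    have "h j \<noteq> h k" using that insert.hyps(2) insert.prems(1) by (auto simp: inj_on_def)
    moreover have "(h j - h k) * poly Q (h j) = 0"
      using insert.prems(2)[of j] that Q by (simp add: algebra_simps)
    ultimately show ?thesis by simp
  qed
  then have "(\<Prod>k\<in>K. [:- h k, 1:]) dvd Q" using insert.IH insert.prems(1) by simp
  then show ?case unfolding Q prod.insert[OF insert.hyps] by (rule mult_dvd_mono[OF dvd_refl])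
qed simp

text \<open>The \<open>p\<close>-th power of a primitive \<open>d\<close>-th root of unity is again
  primitive, so each linear factor of \<open>cyclotomic_poly d\<close> divides; these factors are
  distinct.\<close>

lemma cyclotomic_poly_dvd_pcompose:
  assumes "d > 0" "coprime p d"
  shows "cyclotomic_poly d dvd pcompose (cyclotomic_poly d) (monom 1 p)"
proof -
  have "(\<Prod>k\<in>totatives d. [:- cis (2 * pi * real k / real d), 1:]) dvd pcompose (cyclotomic_poly d) (monom 1 p)"
  proof (rule prod_linear_factors_dvd[OF _ inj_on_cis_totatives])
    fix k assume "k \<in> totatives d"
    then have "coprime (k * p) d" using assms(2) by (simp add: in_totatives_iff)
    then show "poly (pcompose (cyclotomic_poly d) (monom 1 p)) (cis (2 * pi * real k / real d)) = 0"
      unfolding poly_pcompose poly_monom mult_1 cis_frac_power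
      by (rule poly_cyclotomic_poly_eq_0[OF assms(1)])
  qed simp
  then show ?thesis by (simp only: cyclotomic_poly_def[of d, symmetric])
qed

lemma pcompose_power: "pcompose (p ^ n) q = pcompose p q ^ n" for p q :: "'a :: comm_semiring_1 poly"
  by (induction n) (simp_all add: pcompose_1 pcompose_mult)

lemma dvd_of_cyclotomic_product:
  fixes f :: "int poly" and d e :: "nat \<Rightarrow> nat"
  assumes monic: "lead_coeff f = 1" and d: "\<And>i. i \<in> {1..m} \<Longrightarrow> d i > 0"
    and f: "cpoly f = [:0, 1:] ^ e 0 * (\<Prod>i=1..m. cyclotomic_poly (d i) ^ e i)"
    and p: "prime p" "p > (\<Sum>i=1..m. d i)"
  shows "poly f (int p) dvd poly f (int p ^ p)"
proof -
  let ?X = "monom 1 p :: complex poly"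
  have "[:0, 1:] dvd ?X"
    using prime_gt_0_nat[OF p(1)] poly_eq_0_iff_dvd[of ?X 0] by (simp add: poly_monom)
  then have "[:0, 1:] ^ e 0 dvd pcompose [:0, 1:] ?X ^ e 0" by (simp add: pcompose_pCons dvd_power_same)
  moreover have "(\<Prod>i=1..m. cyclotomic_poly (d i) ^ e i) dvd (\<Prod>i=1..m. pcompose (cyclotomic_poly (d i)) ?X ^ e i)"
  proof (intro prod_dvd_prod dvd_power_same cyclotomic_poly_dvd_pcompose d)
    fix i assume i: "i \<in> {1..m}"
    have "d i \<le> (\<Sum>i=1..m. d i)" using i by (intro member_le_sum) auto
    then have "\<not> p dvd d i" using p(2) d[OF i] by (auto dest: dvd_imp_le)
    then show "coprime p (d i)" using p(1) prime_imp_coprime by blast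
  qed
  ultimately have "cpoly f dvd pcompose (cpoly f) ?X"
    unfolding f pcompose_mult pcompose_power pcompose_prod by (intro mult_dvd_mono) auto
  then have dvd: "cpoly f dvd cpoly (pcompose f (monom 1 p))" by (simp add: cpoly_pcompose cpoly_monom)
  \<comment> \<open>Descent from complex to integer divisibility: the remainder by the monic
    \<open>f\<close> has smaller degree, yet is still divisible by \<open>f\<close> over the complex
    numbers.\<close>
  obtain q r where qr: "pcompose f (monom 1 p) = f * q + r" "r = 0 \<or> degree r < degree f"
    using monic_division[OF monic] by blast
  have "cpoly f dvd cpoly f * cpoly q + cpoly r" using dvd by (simp add: qr(1) cpoly_simps)
  then have "cpoly f dvd cpoly r" by (simp add: dvd_add_right_iff)
  then have "r = 0" using qr(2) dvd_imp_degree_le[of "cpoly f" "cpoly r"] by fastforce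
  then have "poly (pcompose f (monom 1 p)) (int p) = poly f (int p) * poly q (int p)" using qr(1) by simp
  then show ?thesis by (simp add: poly_pcompose poly_monom)
qed

lemma cyclotomic_product_of_roots:
  fixes f :: "int poly"
  assumes monic: "lead_coeff f = 1" and L: "L > 0"
    and roots: "\<And>z. poly (cpoly f) z = 0 \<Longrightarrow> z \<noteq> 0 \<Longrightarrow> z ^ L = 1"
  shows "\<exists>e. cpoly f = [:0, 1:] ^ e 0 * (\<Prod>i=1..L. cyclotomic_poly i ^ e i)"
proof -
  let ?F = "cpoly f"
  let ?h = "\<lambda>z. [:- z, 1:] ^ order z ?F"
  let ?c = "\<lambda>i k. cis (2 * pi * real k / real i)"
  let ?R = "{z::complex. z ^ L = 1}"
  have f0: "f \<noteq> 0" using monic by auto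
  have fin: "finite ?R" using L finite_nth_roots[of L 1] by simp
  \<comment> \<open>The order at one primitive \<open>i\<close>-th root serves for all of them, by
    conjugacy. The value 0 for \<open>i\<close> not dividing \<open>L\<close> lets the product run
    over \<open>{1..L}\<close>.\<close>
  define e where "e = (\<lambda>i. if i = 0 then order 0 ?F else if i dvd L then order (?c i 1) ?F else 0)"
  have order_eq: "order (?c i k) ?F = e i" if "i dvd L" "k \<in> totatives i" for i k
  proof -
    have "i > 0" using that(2) by (auto simp: in_totatives_iff)
    moreover have "?c i 1 ^ i = 1"
      using \<open>i > 0\<close> by (simp only: cis_frac_power) simp
    moreover have "?c i 1 ^ k = ?c i k" by (simp only: cis_frac_power mult_1)
    ultimately show ?thesis
      using order_root_of_unity_conj[of i "?c i 1" k f] that f0 by (simp add: in_totatives_iff e_def)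
  qed
  have "?F = (\<Prod>z | poly ?F z = 0. ?h z)"
    using complex_poly_decompose[of ?F] monic by simp
  \<comment> \<open>The points added to the root set have order 0 and contribute the factor
    1.\<close>
  also have "\<dots> = (\<Prod>z\<in>insert 0 ?R. ?h z)"
    using fin roots by (intro prod.mono_neutral_left) (auto simp: order_0I)
  also have "\<dots> = ?h 0 * (\<Prod>z\<in>?R. ?h z)"
    using fin L by (intro prod.insert) (auto simp: zero_power)
  also have "(\<Prod>z\<in>?R. ?h z) = (\<Prod>(i, k)\<in>(SIGMA i:{i. i dvd L}. totatives i). ?h (?c i k))"
    using prod.reindex_bij_betw[OF bij_betw_roots_of_unity_totatives[OF L], of ?h]
    by (simp add: case_prod_unfold)
  also have "\<dots> = (\<Prod>i | i dvd L. \<Prod>k\<in>totatives i. ?h (?c i k))"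
    using L by (intro prod.Sigma[symmetric]) auto
  also have "\<dots> = (\<Prod>i | i dvd L. cyclotomic_poly i ^ e i)"
    by (intro prod.cong refl) (simp add: order_eq cyclotomic_poly_def prod_power_distrib)
  also have "\<dots> = (\<Prod>i=1..L. cyclotomic_poly i ^ e i)"
    using L by (intro prod.mono_neutral_left) (auto simp: e_def dest: dvd_imp_le intro: Nat.gr0I)
  finally show ?thesis by (intro exI[of _ e]) (simp add: e_def)
qed

theorem theorem2p1:
  fixes f :: "int poly"
  assumes monic: "lead_coeff f = 1"
  shows "(\<exists>N::nat. N > 0 \<and>
            (\<forall>p::nat. prime p \<and> p \<ge> N \<longrightarrow> poly f (int p) dvd poly f (int p ^ p)))
     \<longleftrightarrow> (\<exists>(m::nat) (d::nat \<Rightarrow> nat) (e::nat \<Rightarrow> nat).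
            (\<forall>i\<in>{1..m}. d i > 0) \<and>
            (map_poly of_int f :: complex poly) =
              [:0, 1:] ^ e 0 * (\<Prod>i=1..m. cyclotomic_poly (d i) ^ e i))"
  (is "?dvd \<longleftrightarrow> ?cyclotomic")
proof
  assume ?dvd
  then obtain N where N: "\<And>p. prime p \<Longrightarrow> p \<ge> N \<Longrightarrow> poly f (int p) dvd poly f (int p ^ p)"
    by blast
  define L :: nat where "L = fact (degree f * (degree f + 1))"
  have roots: "z ^ L = 1" if "poly (cpoly f) z = 0" "z \<noteq> 0" for z
    unfolding L_def by (rule roots_are_roots_of_unity[OF monic N that])
  have "L > 0" by (simp add: L_def)
  then obtain e where e: "cpoly f = [:0, 1:] ^ e 0 * (\<Prod>i=1..L. cyclotomic_poly i ^ e i)"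
    using cyclotomic_product_of_roots[OF monic _ roots] by blast
  show ?cyclotomic
    by (intro exI[of _ L] exI[of _ "\<lambda>i. i"] exI[of _ e] conjI e) auto
next
  assume ?cyclotomic
  then obtain m :: nat and d e :: "nat \<Rightarrow> nat" where d: "\<And>i. i \<in> {1..m} \<Longrightarrow> d i > 0"
    and f: "cpoly f = [:0, 1:] ^ e 0 * (\<Prod>i=1..m. cyclotomic_poly (d i) ^ e i)"
    by blast
  \<comment> \<open>A prime above the sum exceeds every \<open>d i\<close> and so divides none of
    them; \<open>Suc\<close> gives the strict inequality and positivity even for
    \<open>m = 0\<close>.\<close>
  show ?dvd
    by (intro exI[of _ "Suc (\<Sum>i=1..m. d i)"] conjI allI impI dvd_of_cyclotomic_product[OF monic d f]) auto
qed

end
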